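(* Let $r\geq 0$ and $q\geq 2$ be integers with $q+r\geq 3$, let $X=\mathbb{R}^r\times\mathbb{H}^q_{\mathbb{R}}$ and let $d\in\mathbb{N}$. There is a constant $C=C(X,d)$ such that for any finite graph $\Gamma$ with maximal degree at most $d$ there is a $1$-thick topological embedding of $\Gamma$ into $X$ with volume $$\leq C|\Gamma|^{1+1/(q+r-2)}.$$
   Context: $\mathbb{H}^q_{\mathbb{R}}$ is real hyperbolic space of dimension $q$, and $X$ carries the product Riemannian metric and its Riemannian volume. A graph $\Gamma=(V\Gamma,E\Gamma)$ consists of a set $V\Gamma$ of vertices and a set $E\Gamma$ of unordered pairs of distinct vertices (edges). $\Gamma$ also denotes its topological realisation (one unit interval for each edge, with endpoints labelled by the same vertex identified). $|\Gamma|$ is the number of vertices. For a metric space $Z$ and $\varepsilon>0$, a topological embedding $g:\Gamma\to Z$ is $\varepsilon$-thick if $d_Z(g(x),g(y))\geq\varepsilon$ whenever $x,y$ are: two distinct vertices; an edge and a vertex not contained in that edge; or two disjoint edges (the distance being the distance between the image sets). The volume of $g$ is the measure of the $1$-neighbourhood of its image. *)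

theory Defs
  imports "HOL-Analysis.Analysis"
begin

text \<open>An edge is an unordered pair of distinct vertices, that is, a two-element set.\<close>

definition simple_graph :: "'v set \<Rightarrow> 'v set set \<Rightarrow> bool" where
  "simple_graph V E \<longleftrightarrow> (\<forall>e\<in>E. e \<subseteq> V \<and> card e = 2)"

definition vertex_degree :: "'v set set \<Rightarrow> 'v \<Rightarrow> nat" where
  "vertex_degree E v = card {e \<in> E. v \<in> e}"

text \<open>
  Points of the realisation are labelled by their barycentric coordinates:
  \<open>edge_point u v t\<close> is the point at parameter \<open>t\<close> of the unit interval glued in for the
  edge \<open>{u, v}\<close>, traversed from \<open>u\<close> to \<open>v\<close>.
\<close>

definition vertex_point :: "'v \<Rightarrow> 'v \<Rightarrow> real" where
  "vertex_point v = (\<lambda>w. if w = v then 1 else 0)"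

definition edge_point :: "'v \<Rightarrow> 'v \<Rightarrow> real \<Rightarrow> 'v \<Rightarrow> real" where
  "edge_point u v t = (\<lambda>w. (1 - t) * vertex_point u w + t * vertex_point v w)"

definition edge_cell :: "'v set \<Rightarrow> ('v \<Rightarrow> real) set" where
  "edge_cell e = {edge_point u v t | u v t. e = {u, v} \<and> t \<in> {0..1}}"

definition realisation_points :: "'v set \<Rightarrow> 'v set set \<Rightarrow> ('v \<Rightarrow> real) set" where
  "realisation_points V E = vertex_point ` V \<union> (\<Union>e\<in>E. edge_cell e)"

text \<open>The quotient topology of the disjoint union of the vertices and of the unit intervals.\<close>

definition realisation :: "'v set \<Rightarrow> 'v set set \<Rightarrow> ('v \<Rightarrow> real) topology" where
  "realisation V E = topology (\<lambda>U. U \<subseteq> realisation_points V E \<and>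
     (\<forall>u v. {u, v} \<in> E \<longrightarrow> openin (top_of_set {0..1}) {t \<in> {0..1}. edge_point u v t \<in> U}))"

lemma openin_realisation:
  "openin (realisation V E) U \<longleftrightarrow> U \<subseteq> realisation_points V E \<and>
     (\<forall>u v. {u, v} \<in> E \<longrightarrow> openin (top_of_set {0..1}) {t \<in> {0..1}. edge_point u v t \<in> U})"
proof -
  have "istopology (\<lambda>U. U \<subseteq> realisation_points V E \<and>
     (\<forall>u v. {u, v} \<in> E \<longrightarrow> openin (top_of_set {0..1}) {t \<in> {0..1::real}. edge_point u v t \<in> U}))"
    unfolding istopology_def
  proof (rule conjI; clarify)
    fix S T
    assume S: "S \<subseteq> realisation_points V E" and T: "T \<subseteq> realisation_points V E"
      and oS: "\<forall>u v. {u, v} \<in> E \<longrightarrow> openin (top_of_set {0..1}) {t \<in> {0..1::real}. edge_point u v t \<in> S}"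
      and oT: "\<forall>u v. {u, v} \<in> E \<longrightarrow> openin (top_of_set {0..1}) {t \<in> {0..1::real}. edge_point u v t \<in> T}"
    have "openin (top_of_set {0..1}) {t \<in> {0..1::real}. edge_point u v t \<in> S \<inter> T}"
      if "{u, v} \<in> E" for u v
    proof -
      have "{t \<in> {0..1::real}. edge_point u v t \<in> S \<inter> T} =
        {t \<in> {0..1}. edge_point u v t \<in> S} \<inter> {t \<in> {0..1}. edge_point u v t \<in> T}" by auto
      then show ?thesis using oS oT that by (simp add: openin_Int)
    qed
    then show "S \<inter> T \<subseteq> realisation_points V E \<and>
       (\<forall>u v. {u, v} \<in> E \<longrightarrow> openin (top_of_set {0..1}) {t \<in> {0..1::real}. edge_point u v t \<in> S \<inter> T})"
      using S by auto
  next
    fix \<U>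
    assume \<U>: "\<forall>S\<in>\<U>. S \<subseteq> realisation_points V E \<and>
       (\<forall>u v. {u, v} \<in> E \<longrightarrow> openin (top_of_set {0..1}) {t \<in> {0..1::real}. edge_point u v t \<in> S})"
    have "openin (top_of_set {0..1}) {t \<in> {0..1::real}. edge_point u v t \<in> \<Union>\<U>}"
      if "{u, v} \<in> E" for u v
    proof -
      have "{t \<in> {0..1::real}. edge_point u v t \<in> \<Union>\<U>} =
        (\<Union>S\<in>\<U>. {t \<in> {0..1}. edge_point u v t \<in> S})" by auto
      then show ?thesis using \<U> that by auto
    qed
    then show "\<Union>\<U> \<subseteq> realisation_points V E \<and>
       (\<forall>u v. {u, v} \<in> E \<longrightarrow> openin (top_of_set {0..1}) {t \<in> {0..1::real}. edge_point u v t \<in> \<Union>\<U>})"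
      using \<U> by blast
  qed
  then show ?thesis by (simp add: realisation_def topology_inverse')
qed


definition set_dist :: "('z \<Rightarrow> 'z \<Rightarrow> real) \<Rightarrow> 'z set \<Rightarrow> 'z set \<Rightarrow> real" where
  "set_dist \<delta> A B = (INF (a, b) \<in> A \<times> B. \<delta> a b)"

definition thick_embedding ::
  "'z metric \<Rightarrow> real \<Rightarrow> 'v set \<Rightarrow> 'v set set \<Rightarrow> (('v \<Rightarrow> real) \<Rightarrow> 'z) \<Rightarrow> bool" where
  "thick_embedding Z \<epsilon> V E g \<longleftrightarrow>
     embedding_map (realisation V E) (mtopology_of Z) g \<and>
     (\<forall>u\<in>V. \<forall>v\<in>V. u \<noteq> v \<longrightarrow> \<epsilon> \<le> mdist Z (g (vertex_point u)) (g (vertex_point v))) \<and>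
     (\<forall>e\<in>E. \<forall>v\<in>V. v \<notin> e \<longrightarrow> \<epsilon> \<le> set_dist (mdist Z) (g ` edge_cell e) {g (vertex_point v)}) \<and>
     (\<forall>e\<in>E. \<forall>f\<in>E. e \<inter> f = {} \<longrightarrow> \<epsilon> \<le> set_dist (mdist Z) (g ` edge_cell e) (g ` edge_cell f))"

text \<open>
  The neighbourhood is taken closed; for compact \<open>A\<close> in a Riemannian manifold it differs from the
  open one by a null set.
\<close>

definition nbhd :: "'z metric \<Rightarrow> real \<Rightarrow> 'z set \<Rightarrow> 'z set" where
  "nbhd Z \<rho> A = {z \<in> mspace Z. \<exists>a\<in>A. mdist Z z a \<le> \<rho>}"

definition embedding_volume ::
  "'z metric \<Rightarrow> 'z measure \<Rightarrow> 'v set \<Rightarrow> 'v set set \<Rightarrow> (('v \<Rightarrow> real) \<Rightarrow> 'z) \<Rightarrow> ennreal" where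
  "embedding_volume Z \<mu> V E g = emeasure \<mu> (nbhd Z 1 (g ` realisation_points V E))"


text \<open>
  Hyperbolic space is the upper half-space model. In the global chart used here, coordinates
  \<open>0, \<dots>, r - 1\<close> are those of the Euclidean factor, coordinates \<open>r, \<dots>, r + q - 1\<close> those of the
  hyperbolic factor, the last one being the height. The product metric tensor is diagonal, and
  \<open>metric_coeff r q p i\<close> is its \<open>i\<close>-th diagonal entry at \<open>p\<close>.
\<close>

definition RH_carrier :: "nat \<Rightarrow> nat \<Rightarrow> (nat \<Rightarrow> real) set" where
  "RH_carrier r q = {p \<in> {..<r + q} \<rightarrow>\<^sub>E UNIV. p (r + q - 1) > 0}"

definition metric_coeff :: "nat \<Rightarrow> nat \<Rightarrow> (nat \<Rightarrow> real) \<Rightarrow> nat \<Rightarrow> real" where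
  "metric_coeff r q p i = (if i < r then 1 else 1 / (p (r + q - 1))\<^sup>2)"

definition speed :: "nat \<Rightarrow> nat \<Rightarrow> (real \<Rightarrow> nat \<Rightarrow> real) \<Rightarrow> real \<Rightarrow> real" where
  "speed r q \<gamma> t = sqrt (\<Sum>i<r + q. metric_coeff r q (\<gamma> t) i *
     (vector_derivative (\<lambda>s. \<gamma> s i) (at t))\<^sup>2)"

text \<open>
  Lengths of piecewise continuously differentiable curves from \<open>a\<close> to \<open>b\<close>. Since
  \<^const>\<open>valid_path\<close> allows the derivative to be unbounded near the finitely many break points, the
  speed need not be integrable; \<^const>\<open>has_integral\<close> restricts to curves of finite length.
\<close>

definition curve_lengths :: "nat \<Rightarrow> nat \<Rightarrow> (nat \<Rightarrow> real) \<Rightarrow> (nat \<Rightarrow> real) \<Rightarrow> real set" where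
  "curve_lengths r q a b = {L. \<exists>\<gamma>. (\<forall>t\<in>{0..1}. \<gamma> t \<in> RH_carrier r q) \<and>
     (\<forall>i<r + q. valid_path (\<lambda>t. \<gamma> t i)) \<and> \<gamma> 0 = a \<and> \<gamma> 1 = b \<and>
     (speed r q \<gamma> has_integral L) {0..1}}"

text \<open>The value outside the carrier is irrelevant; \<^locale>\<open>Metric_space\<close> requires it to be
  nonnegative and symmetric.\<close>

definition RH_dist :: "nat \<Rightarrow> nat \<Rightarrow> (nat \<Rightarrow> real) \<Rightarrow> (nat \<Rightarrow> real) \<Rightarrow> real" where
  "RH_dist r q a b =
     (if a \<in> RH_carrier r q \<and> b \<in> RH_carrier r q then Inf (curve_lengths r q a b) else 0)"

lemma RH_carrierD: "p \<in> RH_carrier r q \<Longrightarrow> p (r + q - 1) > 0"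
  by (simp add: RH_carrier_def)

lemma RH_carrier_eqI:
  "\<lbrakk>a \<in> RH_carrier r q; b \<in> RH_carrier r q; \<And>i. i < r + q \<Longrightarrow> a i = b i\<rbrakk> \<Longrightarrow> a = b"
  by (auto simp: RH_carrier_def intro: PiE_ext)

lemma metric_coeff_nonneg: "0 \<le> metric_coeff r q p i"
  by (simp add: metric_coeff_def)

lemma speed_nonneg: "0 \<le> speed r q \<gamma> t"
  by (simp add: speed_def sum_nonneg metric_coeff_nonneg)

lemma speed_cong:
  assumes "\<gamma> t = \<gamma>' t'"
    and "\<And>i. i < r + q \<Longrightarrow> vector_derivative (\<lambda>s. \<gamma> s i) (at t) =
           c * vector_derivative (\<lambda>s. \<gamma>' s i) (at t')"
  shows "speed r q \<gamma> t = \<bar>c\<bar> * speed r q \<gamma>' t'"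
proof -
  have "(\<Sum>i<r + q. metric_coeff r q (\<gamma> t) i * (vector_derivative (\<lambda>s. \<gamma> s i) (at t))\<^sup>2) =
     c\<^sup>2 * (\<Sum>i<r + q. metric_coeff r q (\<gamma>' t') i * (vector_derivative (\<lambda>s. \<gamma>' s i) (at t'))\<^sup>2)"
    using assms by (simp add: sum_distrib_left power_mult_distrib mult_ac)
  then show ?thesis by (simp add: speed_def real_sqrt_mult)
qed

lemma speed_ge_component:
  assumes "i < r + q"
  shows "sqrt (metric_coeff r q (\<gamma> t) i) * \<bar>vector_derivative (\<lambda>s. \<gamma> s i) (at t)\<bar> \<le> speed r q \<gamma> t"
proof -
  let ?f = "\<lambda>i. metric_coeff r q (\<gamma> t) i * (vector_derivative (\<lambda>s. \<gamma> s i) (at t))\<^sup>2"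
  have "?f i \<le> (\<Sum>i<r + q. ?f i)"
    using assms by (intro member_le_sum) (auto simp: metric_coeff_nonneg)
  then have "sqrt (?f i) \<le> speed r q \<gamma> t"
    unfolding speed_def by (rule real_sqrt_le_mono)
  then show ?thesis by (simp add: real_sqrt_mult)
qed

lemma valid_path_differentiable:
  assumes "\<And>i. i < (n::nat) \<Longrightarrow> valid_path (\<lambda>t. \<gamma> t i :: real)"
  obtains S where "finite S"
    "\<And>i t. \<lbrakk>i < n; t \<in> {0..1} - S\<rbrakk> \<Longrightarrow> (\<lambda>t. \<gamma> t i) differentiable (at t)"
proof -
  have "\<forall>i\<in>{..<n}. \<exists>S. finite S \<and> (\<forall>t\<in>{0..1} - S. (\<lambda>t. \<gamma> t i) differentiable (at t))"
  proof
    fix i assume "i \<in> {..<n}"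
    then have "valid_path (\<lambda>t. \<gamma> t i)" using assms by simp
    then show "\<exists>S. finite S \<and> (\<forall>t\<in>{0..1} - S. (\<lambda>t. \<gamma> t i) differentiable (at t))"
      by (auto simp: valid_path_def piecewise_C1_differentiable_on_def C1_differentiable_on_eq)
  qed
  then obtain S where S: "\<forall>i\<in>{..<n}. finite (S i) \<and>
      (\<forall>t\<in>{0..1} - S i. (\<lambda>t. \<gamma> t i) differentiable (at t))"
    by (rule bchoice[THEN exE])
  show thesis
    by (rule that[of "\<Union>i<n. S i"]) (use S in auto)
qed

lemma curve_lengths_nonneg: "L \<in> curve_lengths r q a b \<Longrightarrow> 0 \<le> L"
  unfolding curve_lengths_def by (auto intro: has_integral_nonneg speed_nonneg)

lemma curve_lengths_nonempty:
  assumes a: "a \<in> RH_carrier r q" and b: "b \<in> RH_carrier r q"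
  shows "curve_lengths r q a b \<noteq> {}"
proof -
  define \<gamma> where "\<gamma> = (\<lambda>t::real. \<lambda>i. if i < r + q then (1 - t) * a i + t * b i else undefined)"
  have h: "0 < \<gamma> t (r + q - 1)" if "t \<in> {0..1}" "r + q > 0" for t
  proof -
    have "0 < (1 - t) * a (r + q - 1) + t * b (r + q - 1)"
      using that RH_carrierD[OF a] RH_carrierD[OF b]
      by (cases "t = 1") (auto intro: add_pos_nonneg)
    then show ?thesis using that by (simp add: \<gamma>_def)
  qed
  have 0: "\<gamma> 0 = a" and 1: "\<gamma> 1 = b"
    using a b by (auto simp: \<gamma>_def RH_carrier_def PiE_def extensional_def)
  have car: "\<gamma> t \<in> RH_carrier r q" if "t \<in> {0..1}" for t
  proof (cases "r + q = 0")
    case True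
    then show ?thesis using a 0 by (auto simp: \<gamma>_def)
  next
    case False
    then show ?thesis using h[OF that] by (auto simp: RH_carrier_def \<gamma>_def PiE_def extensional_def)
  qed
  have vd: "((\<lambda>s. \<gamma> s i) has_vector_derivative b i - a i) (at t)" if "i < r + q" for i t
    using that unfolding \<gamma>_def
    by (auto intro!: derivative_eq_intros simp: has_real_derivative_iff_has_vector_derivative[symmetric])
  have vp: "valid_path (\<lambda>t. \<gamma> t i)" if "i < r + q" for i
  proof -
    have "(\<lambda>t. \<gamma> t i) = linepath (a i) (b i)"
      using that by (auto simp: \<gamma>_def linepath_def)
    then show ?thesis by (simp only: valid_path_linepath)
  qed
  have "continuous_on {0..1} (\<lambda>t. sqrt (\<Sum>i<r + q. metric_coeff r q (\<gamma> t) i * (b i - a i)\<^sup>2))"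
  proof (intro continuous_intros)
    fix i assume i: "i \<in> {..<r + q}"
    have "continuous_on {0..1} (\<lambda>t. \<gamma> t (r + q - 1))"
      using i unfolding \<gamma>_def by (cases "r + q - 1 < r + q") (simp_all only: if_True if_False, intro continuous_intros, auto)
    then show "continuous_on {0..1} (\<lambda>t. metric_coeff r q (\<gamma> t) i)"
      using h i unfolding metric_coeff_def by (cases "i < r") (auto intro!: continuous_intros dest!: spec simp: less_imp_neq[symmetric])
  qed
  moreover have "speed r q \<gamma> = (\<lambda>t. sqrt (\<Sum>i<r + q. metric_coeff r q (\<gamma> t) i * (b i - a i)\<^sup>2))"
    unfolding speed_def by (intro ext arg_cong[where f=sqrt] sum.cong refl) (simp add: vector_derivative_at[OF vd])
  ultimately have "speed r q \<gamma> integrable_on {0..1}"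
    by (simp add: integrable_continuous_real)
  then have "(speed r q \<gamma> has_integral integral {0..1} (speed r q \<gamma>)) {0..1}"
    by (rule integrable_integral)
  with 0 1 car vp have "integral {0..1} (speed r q \<gamma>) \<in> curve_lengths r q a b"
    unfolding curve_lengths_def by blast
  then show ?thesis by blast
qed

lemma curve_lengths_reverse:
  assumes "L \<in> curve_lengths r q a b"
  shows "L \<in> curve_lengths r q b a"
proof -
  obtain \<gamma> where car: "\<And>t. t \<in> {0..1} \<Longrightarrow> \<gamma> t \<in> RH_carrier r q"
    and vp: "\<And>i. i < r + q \<Longrightarrow> valid_path (\<lambda>t. \<gamma> t i)" and ends: "\<gamma> 0 = a" "\<gamma> 1 = b"
    and L: "(speed r q \<gamma> has_integral L) {0..1}"
    using assms unfolding curve_lengths_def by blast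
  obtain S where S: "finite S"
    "\<And>i t. \<lbrakk>i < r + q; t \<in> {0..1} - S\<rbrakk> \<Longrightarrow> (\<lambda>t. \<gamma> t i) differentiable (at t)"
    using valid_path_differentiable[of "r + q" \<gamma>] vp by blast
  define \<gamma>' where "\<gamma>' = (\<lambda>t. \<gamma> (1 - t))"
  have sp: "speed r q \<gamma>' t = speed r q \<gamma> (1 - t)" if t: "t \<in> {0..1} - (\<lambda>t. 1 - t) ` S" for t
  proof -
    have "1 - t \<in> {0..1} - S" using t by (force simp: image_iff)
    then have d: "((\<lambda>t. \<gamma> t i) has_vector_derivative vector_derivative (\<lambda>t. \<gamma> t i) (at (1 - t))) (at (1 - t))"
      if "i < r + q" for i using S(2) that by (simp add: vector_derivative_works)
    have "((\<lambda>t. 1 - t) has_vector_derivative (-1::real)) (at t)"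
      by (auto intro!: derivative_eq_intros simp: has_real_derivative_iff_has_vector_derivative[symmetric])
    from vector_diff_chain_at[OF this d]
    have "vector_derivative (\<lambda>s. \<gamma>' s i) (at t) = (-1) * vector_derivative (\<lambda>t. \<gamma> t i) (at (1 - t))"
      if "i < r + q" for i using that
      by (intro vector_derivative_at) (auto simp: \<gamma>'_def o_def)
    from speed_cong[OF _ this] show ?thesis by (simp add: \<gamma>'_def)
  qed
  have "((\<lambda>t. speed r q \<gamma> (1 - t)) has_integral L) {0..1}"
    using has_integral_affinity01[OF L, of "-1" 1] by simp
  then have "(speed r q \<gamma>' has_integral L) {0..1}"
    by (rule has_integral_spike_finite[of "(\<lambda>t. 1 - t) ` S", rotated 2]) (use S(1) sp in auto)
  moreover have "valid_path (\<lambda>t. \<gamma>' t i)" if "i < r + q" for i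
    using valid_path_imp_reverse[OF vp[OF that]] by (simp add: \<gamma>'_def reversepath_def)
  ultimately show ?thesis
    unfolding curve_lengths_def
    by (intro CollectI exI[of _ \<gamma>']) (use car ends in \<open>auto simp: \<gamma>'_def\<close>)
qed

lemma curve_lengths_join:
  assumes "L1 \<in> curve_lengths r q a b" and "L2 \<in> curve_lengths r q b c"
  shows "L1 + L2 \<in> curve_lengths r q a c"
proof -
  obtain \<gamma>1 where car1: "\<And>t. t \<in> {0..1} \<Longrightarrow> \<gamma>1 t \<in> RH_carrier r q"
    and vp1: "\<And>i. i < r + q \<Longrightarrow> valid_path (\<lambda>t. \<gamma>1 t i)" and ends1: "\<gamma>1 0 = a" "\<gamma>1 1 = b"
    and L1: "(speed r q \<gamma>1 has_integral L1) {0..1}"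
    using assms(1) unfolding curve_lengths_def by blast
  obtain \<gamma>2 where car2: "\<And>t. t \<in> {0..1} \<Longrightarrow> \<gamma>2 t \<in> RH_carrier r q"
    and vp2: "\<And>i. i < r + q \<Longrightarrow> valid_path (\<lambda>t. \<gamma>2 t i)" and ends2: "\<gamma>2 0 = b" "\<gamma>2 1 = c"
    and L2: "(speed r q \<gamma>2 has_integral L2) {0..1}"
    using assms(2) unfolding curve_lengths_def by blast
  obtain S1 where S1: "finite S1"
    "\<And>i t. \<lbrakk>i < r + q; t \<in> {0..1} - S1\<rbrakk> \<Longrightarrow> (\<lambda>t. \<gamma>1 t i) differentiable (at t)"
    using valid_path_differentiable[of "r + q" \<gamma>1] vp1 by blast
  obtain S2 where S2: "finite S2"
    "\<And>i t. \<lbrakk>i < r + q; t \<in> {0..1} - S2\<rbrakk> \<Longrightarrow> (\<lambda>t. \<gamma>2 t i) differentiable (at t)"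
    using valid_path_differentiable[of "r + q" \<gamma>2] vp2 by blast
  define \<gamma> where "\<gamma> = (\<lambda>t. if t \<le> 1/2 then \<gamma>1 (2 * t) else \<gamma>2 (2 * t - 1))"
  have vp: "valid_path (\<lambda>t. \<gamma> t i)" if "i < r + q" for i
  proof -
    have "(\<lambda>t. \<gamma> t i) = (\<lambda>t. \<gamma>1 t i) +++ (\<lambda>t. \<gamma>2 t i)"
      by (auto simp: \<gamma>_def joinpaths_def)
    then show ?thesis
      using vp1[OF that] vp2[OF that] ends1 ends2
      by (simp only:) (rule valid_path_join, auto simp: pathfinish_def pathstart_def)
  qed
  have sp1: "speed r q \<gamma> t = 2 * speed r q \<gamma>1 (2 * t)"
    if t: "t \<in> {0..1/2} - insert (1/2) ((*) 2 -` S1)" for t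
  proof -
    have "vector_derivative (\<lambda>s. \<gamma> s i) (at t) = 2 * vector_derivative (\<lambda>s. \<gamma>1 s i) (at (2 * t))"
      if i: "i < r + q" for i
    proof (rule vector_derivative_at[OF has_vector_derivative_transform_within])
      have d: "((\<lambda>t. \<gamma>1 t i) has_vector_derivative vector_derivative (\<lambda>t. \<gamma>1 t i) (at (2 * t))) (at (2 * t))"
        using S1(2) i t by (simp add: vector_derivative_works[symmetric])
      have "((*) 2 has_vector_derivative (2::real)) (at t)"
        by (auto intro!: derivative_eq_intros simp: has_real_derivative_iff_has_vector_derivative[symmetric])
      from vector_diff_chain_at[OF this d]
      show "((\<lambda>s. \<gamma>1 (2 * s) i) has_vector_derivative 2 * vector_derivative (\<lambda>s. \<gamma>1 s i) (at (2 * t))) (at t)"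
        by (simp add: o_def)
      show "0 < \<bar>t - 1/2\<bar>" using t by auto
    qed (use t in \<open>auto simp: \<gamma>_def dist_real_def abs_if split: if_split_asm\<close>)
    from speed_cong[OF _ this] show ?thesis using t by (simp add: \<gamma>_def)
  qed
  have sp2: "speed r q \<gamma> t = 2 * speed r q \<gamma>2 (2 * t - 1)"
    if t: "t \<in> {1/2..1} - insert (1/2) ((\<lambda>t. 2 * t - 1) -` S2)" for t
  proof -
    have "vector_derivative (\<lambda>s. \<gamma> s i) (at t) = 2 * vector_derivative (\<lambda>s. \<gamma>2 s i) (at (2 * t - 1))"
      if i: "i < r + q" for i
    proof (rule vector_derivative_at[OF has_vector_derivative_transform_within])
      have d: "((\<lambda>t. \<gamma>2 t i) has_vector_derivative vector_derivative (\<lambda>t. \<gamma>2 t i) (at (2 * t - 1))) (at (2 * t - 1))"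
        using S2(2) i t by (simp add: vector_derivative_works[symmetric])
      have "((\<lambda>t. 2 * t - 1) has_vector_derivative (2::real)) (at t)"
        by (auto intro!: derivative_eq_intros simp: has_real_derivative_iff_has_vector_derivative[symmetric])
      from vector_diff_chain_at[OF this d]
      show "((\<lambda>s. \<gamma>2 (2 * s - 1) i) has_vector_derivative 2 * vector_derivative (\<lambda>s. \<gamma>2 s i) (at (2 * t - 1))) (at t)"
        by (simp add: o_def)
      show "0 < \<bar>t - 1/2\<bar>" using t by auto
    qed (use t in \<open>auto simp: \<gamma>_def dist_real_def abs_if split: if_split_asm\<close>)
    from speed_cong[OF _ this] show ?thesis using t by (simp add: \<gamma>_def)
  qed
  have i1: "((\<lambda>t. 2 * speed r q \<gamma>1 (2 * t)) has_integral L1) {0..1/2}"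
    using has_integral_affinity01[OF L1, where m=2 and c=0, THEN has_integral_cmul[where c=2]]
    by (simp_all only: image_affinity_atLeastAtMost_div_diff, simp_all add: mult_ac)
  have i2: "((\<lambda>t. 2 * speed r q \<gamma>2 (2 * t - 1)) has_integral L2) {1/2..1}"
    using has_integral_affinity01[OF L2, where m=2 and c="-1", THEN has_integral_cmul[where c=2]]
    by (simp_all only: image_affinity_atLeastAtMost_div_diff, simp_all add: mult_ac)
  have "(speed r q \<gamma> has_integral L1) {0..1/2}"
  proof (rule has_integral_spike_finite[OF _ _ i1])
    show "finite (insert (1/2) ((*) 2 -` S1))"
      using S1(1) by (force intro: finite_vimageI[where h = "(*) 2"] inj_onI)
  qed (rule sp1)
  moreover have "(speed r q \<gamma> has_integral L2) {1/2..1}"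
  proof (rule has_integral_spike_finite[OF _ _ i2])
    show "finite (insert (1/2) ((\<lambda>t. 2 * t - 1) -` S2))"
      using S2(1) by (force intro: finite_vimageI[where h = "\<lambda>t. 2 * t - 1"] inj_onI)
  qed (rule sp2)
  ultimately have "(speed r q \<gamma> has_integral L1 + L2) {0..1}"
    by (intro has_integral_combine[where c = "1/2"]) auto
  then show ?thesis
    unfolding curve_lengths_def
    by (intro CollectI exI[of _ \<gamma>])
      (use car1 car2 ends1 ends2 vp in \<open>auto simp: \<gamma>_def\<close>)
qed

lemma displacement_le_length:
  fixes f :: "real \<Rightarrow> real"
  assumes L: "(s has_integral L) {0..1}" and s: "\<And>t. t \<in> {0..1} \<Longrightarrow> 0 \<le> s t"
    and S: "finite S" and f: "continuous_on {0..1} f"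
    and f': "\<And>t. t \<in> {0..1} - S \<Longrightarrow> (f has_vector_derivative f' t) (at t)"
    and bound: "\<And>t. t \<in> {0..1} - S \<Longrightarrow> \<bar>f' t\<bar> \<le> K * s t"
    and K: "0 \<le> K" and \<tau>: "\<tau> \<in> {0..1}"
  shows "\<bar>f \<tau> - f 0\<bar> \<le> K * L"
proof -
  have int: "s integrable_on {0..\<tau>}"
    using L \<tau> by (auto intro: integrable_on_subinterval dest: has_integral_integrable)
  define g where "g = (\<lambda>t. if t \<in> S then 0 else f' t)"
  have "(g has_integral (f \<tau> - f 0)) {0..\<tau>}"
    by (rule fundamental_theorem_of_calculus_strong[OF S])
      (use \<tau> f' f in \<open>auto simp: g_def intro: continuous_on_subset\<close>)
  moreover have "((\<lambda>t. K * s t) has_integral K * integral {0..\<tau>} s) {0..\<tau>}"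
    using int by (intro has_integral_mult_right integrable_integral)
  moreover have "norm (g t) \<le> K * s t" if "t \<in> {0..\<tau>}" for t
    using that \<tau> bound[of t] s[of t] K by (auto simp: g_def)
  ultimately have "norm (f \<tau> - f 0) \<le> K * integral {0..\<tau>} s"
    by (metis (no_types, lifting) has_integral_integrable integral_norm_bound_integral integral_unique)
  also have "integral {0..\<tau>} s \<le> integral {0..1} s"
    using \<tau> s int L by (intro integral_subset_le) (auto dest: has_integral_integrable)
  also have "integral {0..1} s = L" using L by (rule integral_unique)
  finally show ?thesis using K by (simp add: mult_left_mono)
qed

text \<open>
  The uniform bound that makes \<open>RH_dist\<close> definite: a curve of length \<open>< 1\<close> starting at \<open>a\<close>
  stays below height \<open>exp 1\<close> times that of \<open>a\<close>.
\<close>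

lemma curve_lengths_lower_bound:
  assumes L: "L \<in> curve_lengths r q a b" and i: "i < r + q"
  shows "1 \<le> L \<or> \<bar>b i - a i\<bar> \<le> max 1 (exp 1 * a (r + q - 1)) * L"
proof (cases "1 \<le> L")
  case False
  then have L1: "L \<le> 1" by simp
  let ?h = "r + q - 1"
  obtain \<gamma> where car: "\<And>t. t \<in> {0..1} \<Longrightarrow> \<gamma> t \<in> RH_carrier r q"
    and vp: "\<And>i. i < r + q \<Longrightarrow> valid_path (\<lambda>t. \<gamma> t i)" and ends: "\<gamma> 0 = a" "\<gamma> 1 = b"
    and int: "(speed r q \<gamma> has_integral L) {0..1}"
    using L unfolding curve_lengths_def by blast
  obtain S where S: "finite S"
    "\<And>i t. \<lbrakk>i < r + q; t \<in> {0..1} - S\<rbrakk> \<Longrightarrow> (\<lambda>t. \<gamma> t i) differentiable (at t)"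
    using valid_path_differentiable[of "r + q" \<gamma>] vp by blast
  define D where "D = (\<lambda>i t. vector_derivative (\<lambda>s. \<gamma> s i) (at t))"
  have D: "((\<lambda>t. \<gamma> t i) has_vector_derivative D i t) (at t)" if "i < r + q" "t \<in> {0..1} - S" for i t
    using S(2) that by (simp add: D_def vector_derivative_works[symmetric])
  have cont: "continuous_on {0..1} (\<lambda>t. \<gamma> t i)" if "i < r + q" for i
    using vp[OF that] by (simp add: valid_path_def piecewise_C1_differentiable_on_def)
  have h: "0 < \<gamma> t ?h" if "t \<in> {0..1}" for t
    using RH_carrierD[OF car[OF that]] .
  have comp_low: "\<bar>D i t\<bar> \<le> speed r q \<gamma> t" if "i < r" for i t
    using speed_ge_component[of i r q \<gamma> t] that by (simp add: D_def metric_coeff_def)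
  have comp_hyp: "\<bar>D i t\<bar> \<le> \<gamma> t ?h * speed r q \<gamma> t" if "\<not> i < r" "i < r + q" "t \<in> {0..1}" for i t
    using speed_ge_component[of i r q \<gamma> t] that h[of t]
    by (simp add: D_def metric_coeff_def real_sqrt_divide field_simps)
  have height: "\<gamma> \<tau> ?h \<le> exp 1 * a ?h" if \<tau>: "\<tau> \<in> {0..1}" and hyp: "\<not> i < r" for \<tau>
  proof -
    have lt: "\<not> ?h < r" "?h < r + q" using i hyp by auto
    have "\<bar>ln (\<gamma> \<tau> ?h) - ln (\<gamma> 0 ?h)\<bar> \<le> 1 * L"
    proof (rule displacement_le_length[OF int speed_nonneg S(1)])
      show "continuous_on {0..1} (\<lambda>t. ln (\<gamma> t ?h))"
        using h cont[OF lt(2)] by (intro continuous_on_ln) force+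
      show "((\<lambda>t. ln (\<gamma> t ?h)) has_vector_derivative D ?h t / \<gamma> t ?h) (at t)" if "t \<in> {0..1} - S" for t
        using D[OF lt(2) that] h[of t] that
        by (auto simp: has_real_derivative_iff_has_vector_derivative[symmetric] intro!: derivative_eq_intros)
      show "\<bar>D ?h t / \<gamma> t ?h\<bar> \<le> 1 * speed r q \<gamma> t" if "t \<in> {0..1} - S" for t
        using comp_hyp[OF lt, of t] h[of t] that by (simp add: field_simps)
    qed (use \<tau> in auto)
    then have "ln (\<gamma> \<tau> ?h) \<le> 1 + ln (a ?h)" using L1 ends(1) by simp
    then have "exp (ln (\<gamma> \<tau> ?h)) \<le> exp (1 + ln (a ?h))" by simp
    then show ?thesis using h[OF \<tau>] h[of 0] ends by (simp add: exp_add)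
  qed
  have "\<bar>\<gamma> 1 i - \<gamma> 0 i\<bar> \<le> max 1 (exp 1 * a ?h) * L"
  proof (rule displacement_le_length[OF int speed_nonneg S(1) cont[OF i] D[OF i]])
    show "\<bar>D i t\<bar> \<le> max 1 (exp 1 * a ?h) * speed r q \<gamma> t" if "t \<in> {0..1} - S" for t
    proof (cases "i < r")
      case True
      have "1 * speed r q \<gamma> t \<le> max 1 (exp 1 * a ?h) * speed r q \<gamma> t"
        by (intro mult_right_mono speed_nonneg) auto
      then show ?thesis using comp_low[OF True, of t] by simp
    next
      case False
      have "\<gamma> t ?h * speed r q \<gamma> t \<le> max 1 (exp 1 * a ?h) * speed r q \<gamma> t"
        using height[OF _ False, of t] that by (intro mult_right_mono speed_nonneg) auto
      then show ?thesis using comp_hyp[OF False i, of t] that by simp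
    qed
  qed auto
  then show ?thesis using ends by simp
qed auto

lemma bdd_below_curve_lengths: "bdd_below (curve_lengths r q a b)"
  by (rule bdd_belowI[of _ 0]) (rule curve_lengths_nonneg)

lemma Metric_space_RH: "Metric_space (RH_carrier r q) (RH_dist r q)"
proof
  show "0 \<le> RH_dist r q a b" for a b
    using curve_lengths_nonempty curve_lengths_nonneg
    by (auto simp: RH_dist_def intro!: cInf_greatest)
  show "RH_dist r q a b = RH_dist r q b a" for a b
  proof -
    have "curve_lengths r q a b = curve_lengths r q b a"
      using curve_lengths_reverse by blast
    then show ?thesis by (auto simp: RH_dist_def)
  qed
  show "RH_dist r q a b = 0 \<longleftrightarrow> a = b" if a: "a \<in> RH_carrier r q" and b: "b \<in> RH_carrier r q" for a b
  proof
    assume "a = b"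
    have "speed r q (\<lambda>_. a) = (\<lambda>_. 0)"
      by (simp add: speed_def fun_eq_iff)
    then have "0 \<in> curve_lengths r q a b"
      using a \<open>a = b\<close> unfolding curve_lengths_def
      by (intro CollectI exI[of _ "\<lambda>_. a"]) (auto simp: valid_path_def piecewise_C1_differentiable_on_def)
    then have "Inf (curve_lengths r q a b) \<le> 0"
      by (intro cInf_lower bdd_below_curve_lengths)
    moreover have "0 \<le> Inf (curve_lengths r q a b)"
      using curve_lengths_nonempty[OF a b] curve_lengths_nonneg by (intro cInf_greatest)
    ultimately show "RH_dist r q a b = 0" using a b by (simp add: RH_dist_def)
  next
    assume 0: "RH_dist r q a b = 0"
    let ?K = "max 1 (exp 1 * a (r + q - 1))"
    show "a = b"
    proof (rule RH_carrier_eqI[OF a b], rule ccontr)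
      fix i assume i: "i < r + q" and ne: "a i \<noteq> b i"
      define \<epsilon> where "\<epsilon> = min 1 (\<bar>b i - a i\<bar> / ?K)"
      have K: "?K > 0" by simp
      have "\<epsilon> \<le> L" if "L \<in> curve_lengths r q a b" for L
        using curve_lengths_lower_bound[OF that i] K
        by (auto simp: \<epsilon>_def min_le_iff_disj pos_divide_le_eq mult.commute)
      then have "\<epsilon> \<le> Inf (curve_lengths r q a b)"
        using curve_lengths_nonempty[OF a b] by (intro cInf_greatest)
      moreover have "\<epsilon> > 0" using ne K unfolding \<epsilon>_def by (simp add: divide_pos_pos del: zero_less_divide_iff)
      ultimately show False using 0 a b by (simp add: RH_dist_def)
    qed
  qed
  show "RH_dist r q a c \<le> RH_dist r q a b + RH_dist r q b c"
    if a: "a \<in> RH_carrier r q" and b: "b \<in> RH_carrier r q" and c: "c \<in> RH_carrier r q" for a b c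
  proof -
    have le: "Inf (curve_lengths r q a c) \<le> L1 + L2"
      if "L1 \<in> curve_lengths r q a b" "L2 \<in> curve_lengths r q b c" for L1 L2
      using curve_lengths_join[OF that] by (intro cInf_lower bdd_below_curve_lengths)
    have "Inf (curve_lengths r q a c) - L2 \<le> Inf (curve_lengths r q a b)"
      if "L2 \<in> curve_lengths r q b c" for L2
      using curve_lengths_nonempty[OF a b] le[OF _ that]
      by (intro cInf_greatest) (auto simp: algebra_simps)
    then have "Inf (curve_lengths r q a c) - Inf (curve_lengths r q a b) \<le> Inf (curve_lengths r q b c)"
      using curve_lengths_nonempty[OF b c] by (intro cInf_greatest) (auto simp: algebra_simps)
    then show ?thesis using a b c by (simp add: RH_dist_def)
  qed
qed

definition RH_metric :: "nat \<Rightarrow> nat \<Rightarrow> (nat \<Rightarrow> real) metric" where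
  "RH_metric r q = metric (RH_carrier r q, RH_dist r q)"

lemma mspace_RH_metric: "mspace (RH_metric r q) = RH_carrier r q"
  and mdist_RH_metric: "mdist (RH_metric r q) = RH_dist r q"
  by (simp_all add: RH_metric_def Metric_space_RH Metric_space.mspace_metric Metric_space.mdist_metric)

text \<open>The Riemannian volume has density \<open>sqrt (det g)\<close> in the chart.\<close>

definition RH_volume :: "nat \<Rightarrow> nat \<Rightarrow> (nat \<Rightarrow> real) measure" where
  "RH_volume r q = density (restrict_space (\<Pi>\<^sub>M i\<in>{..<r + q}. lborel) (RH_carrier r q))
     (\<lambda>p. ennreal (sqrt (\<Prod>i<r + q. metric_coeff r q p i)))"

end

theory Submission
  imports Defs
begin

text \<open>
  Put \<open>D = q + r - 2\<close>. A horosphere in the hyperbolic factor times the Euclidean factor is a copy of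
  \<open>\<real>\<^sup>D\<^sup>+\<^sup>1\<close>, and a slab around it of bounded height contains a cube of side a multiple of
  \<open>L = |\<Gamma>|\<^sup>1\<^sup>/\<^sup>D\<close>, whose volume is of the required order \<open>L\<^sup>D\<^sup>+\<^sup>1\<close>. The vertices are placed on a
  \<open>D\<close>-dimensional face, with a block of ports, one for each incident edge. As in the argument of
  Kolmogorov and Barzdin, an edge is routed by changing one column coordinate at a time, first
  towards an intermediate point \<open>c\<close> and then away from it; the intermediate coordinates come from a greedy
  colouring, and \<open>c\<^sub>k\<close> also serves as the level in the last cube direction at which coordinate \<open>k\<close> is
  changed. Instead of being disjoint in the cube, successive pieces of an edge lie at successive
  hyperbolic heights, so a bounded number of heights suffices and this works already for \<open>D = 1\<close>,
  where the cube is a square. Two points at bounded height whose chart coordinates differ enough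
  in a single coordinate have distance at least \<open>1\<close>, so all separation is checked coordinatewise.
\<close>

section \<open>Routing through intermediate points\<close>

text \<open>Elements are coloured one after another: fewer than \<open>S\<close> conflicts always
  leave a colour below \<open>S\<close> free. By symmetry, the colour chosen for the new element
  also respects the conflicts of the earlier ones with it.\<close>

lemma greedy_colouring:
  fixes R :: "'a \<Rightarrow> 'a \<Rightarrow> bool"
  assumes "finite E" and sym: "\<And>e f. R e f \<Longrightarrow> R f e"
    and "\<And>e. e \<in> E \<Longrightarrow> card {f \<in> E. f \<noteq> e \<and> R e f} < S"
  shows "\<exists>c. (\<forall>e\<in>E. c e < S) \<and> (\<forall>e\<in>E. \<forall>f\<in>E. e \<noteq> f \<longrightarrow> R e f \<longrightarrow> c e \<noteq> (c f :: nat))"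
  using assms(1,3)
proof (induction E)
  case (insert a E)
  have small: "card {f \<in> E. f \<noteq> e \<and> R e f} < S" if "e \<in> E" for e
  proof -
    have "card {f \<in> E. f \<noteq> e \<and> R e f} \<le> card {f \<in> insert a E. f \<noteq> e \<and> R e f}"
      using insert.hyps by (intro card_mono) auto
    then show ?thesis using insert.prems[of e] that by simp
  qed
  have "\<exists>c. (\<forall>e\<in>E. c e < S) \<and> (\<forall>e\<in>E. \<forall>f\<in>E. e \<noteq> f \<longrightarrow> R e f \<longrightarrow> c e \<noteq> c f)"
    by (rule insert.IH) (rule small)
  then obtain c where c: "\<forall>e\<in>E. c e < S" "\<forall>e\<in>E. \<forall>f\<in>E. e \<noteq> f \<longrightarrow> R e f \<longrightarrow> c e \<noteq> c f"
    by (elim exE conjE) (rule that)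
  have "card (c ` {f \<in> E. R a f}) \<le> card {f \<in> E. R a f}"
    using insert.hyps by (intro card_image_le) auto
  also have "card {f \<in> E. R a f} = card {f \<in> insert a E. f \<noteq> a \<and> R a f}"
    using insert.hyps by (intro arg_cong[where f = card]) auto
  also have "\<dots> < card {..<S}" using insert.prems[of a] by simp
  finally have "\<not> {..<S} \<subseteq> c ` {f \<in> E. R a f}"
    using insert.hyps by (auto dest!: card_mono[rotated])
  then obtain s where s: "s < S" "s \<notin> c ` {f \<in> E. R a f}" by auto
  have "c f \<noteq> s" if "f \<in> E" "R a f \<or> R f a" for f
    using that s sym[of f a] by auto
  then show ?case
    by (intro exI[of _ "c(a := s)"]) (use s c insert.hyps in \<open>auto simp: image_iff\<close>)
qed simp

text \<open>The position of a route from a port \<open>x\<close> towards the intermediate point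
  \<open>c\<close> once the first \<open>k\<close> column coordinates have been changed.\<close>

definition splice :: "nat \<Rightarrow> (nat \<Rightarrow> nat) \<Rightarrow> (nat \<Rightarrow> nat) \<Rightarrow> nat \<Rightarrow> nat" where
  "splice k c x i = (if i < k then c i else x i)"

definition separating :: "nat \<Rightarrow> 'e set \<Rightarrow> ('e \<Rightarrow> nat \<Rightarrow> nat) \<Rightarrow> bool" where
  "separating D E p \<longleftrightarrow> (\<forall>e\<in>E. \<forall>f\<in>E. e \<noteq> f \<longrightarrow> (\<exists>i<D. p e i \<noteq> p f i))"

text \<open>Edges that agree with \<open>e\<close> outside coordinate \<open>k\<close> differ from
  \<open>e\<close> and from each other in that coordinate, for which at most \<open>B - 1\<close>
  values remain.\<close>

lemma card_line:
  assumes E: "finite E" and sep: "separating D E p" and e: "e \<in> E"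
    and B: "\<And>f. f \<in> E \<Longrightarrow> p f k < B"
  shows "card {f \<in> E. f \<noteq> e \<and> (\<forall>i<D. i \<noteq> k \<longrightarrow> p e i = p f i)} < B"
proof -
  let ?A = "{f \<in> E. f \<noteq> e \<and> (\<forall>i<D. i \<noteq> k \<longrightarrow> p e i = p f i)}"
  have ne: "f = g" if "f \<in> E" "g \<in> E" "\<forall>i<D. i \<noteq> k \<longrightarrow> p g i = p f i" "p f k = p g k" for f g
    using sep that unfolding separating_def by metis
  have "inj_on (\<lambda>f. p f k) ?A"
    by (rule inj_onI) (rule ne, auto)
  moreover have "(\<lambda>f. p f k) ` ?A \<subseteq> {..<B} - {p e k}"
    using ne[of _ e] e B by fastforce
  ultimately have "card ?A \<le> card ({..<B} - {p e k})"
    by (intro card_inj_on_le) auto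
  also have "\<dots> < B" using B[OF e] by simp
  finally show ?thesis .
qed

text \<open>
  The intermediate coordinates are chosen one at a time. Two edges conflict at stage \<open>k\<close> if they
  agree outside coordinate \<open>k\<close> on the source or on the target side, and since the previous stage
  is separating, at most \<open>B - 1\<close> edges lie on each of these two lines.
\<close>

lemma exists_intermediate_points:
  fixes x y :: "'e \<Rightarrow> nat \<Rightarrow> nat"
  assumes E: "finite E" and x: "separating D E x" "\<And>e i. e \<in> E \<Longrightarrow> i < D \<Longrightarrow> x e i < B"
    and y: "separating D E y" "\<And>e i. e \<in> E \<Longrightarrow> i < D \<Longrightarrow> y e i < B"
    and "k \<le> D"
  shows "\<exists>c. (\<forall>e\<in>E. \<forall>i<k. c e i < 2 * B) \<and>
    (\<forall>j\<le>k. separating D E (\<lambda>e. splice j (c e) (x e)) \<and> separating D E (\<lambda>e. splice j (c e) (y e)))"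
  using \<open>k \<le> D\<close>
proof (induction k)
  case 0
  then show ?case using x y by (auto simp: splice_def)
next
  case (Suc k)
  then obtain c where c: "\<forall>e\<in>E. \<forall>i<k. c e i < 2 * B"
    and sep: "\<And>j. j \<le> k \<Longrightarrow> separating D E (\<lambda>e. splice j (c e) (x e))"
      "\<And>j. j \<le> k \<Longrightarrow> separating D E (\<lambda>e. splice j (c e) (y e))"
    by auto
  define P where "P = (\<lambda>x e f. \<forall>i<D. i \<noteq> k \<longrightarrow> splice k (c e) (x e) i = splice k (c f) (x f) i)"
  define R where "R = (\<lambda>e f. P x e f \<or> P y e f)"
  have few: "card {f \<in> E. f \<noteq> e \<and> R e f} < 2 * B" if e: "e \<in> E" for e
  proof -
    have "{f \<in> E. f \<noteq> e \<and> R e f} = {f \<in> E. f \<noteq> e \<and> P x e f} \<union> {f \<in> E. f \<noteq> e \<and> P y e f}"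
      by (auto simp: R_def)
    then have "card {f \<in> E. f \<noteq> e \<and> R e f} \<le> card {f \<in> E. f \<noteq> e \<and> P x e f} + card {f \<in> E. f \<noteq> e \<and> P y e f}"
      by (simp add: card_Un_le)
    moreover have "card {f \<in> E. f \<noteq> e \<and> P x e f} < B" "card {f \<in> E. f \<noteq> e \<and> P y e f} < B"
      unfolding P_def using x y Suc.prems
      by (intro card_line[OF E sep(1)[OF order_refl] e] card_line[OF E sep(2)[OF order_refl] e]; simp add: splice_def)+
    ultimately show ?thesis by linarith
  qed
  have sym: "R f e" if "R e f" for e f using that by (auto simp: R_def P_def)
  have "\<exists>col. (\<forall>e\<in>E. col e < 2 * B) \<and> (\<forall>e\<in>E. \<forall>f\<in>E. e \<noteq> f \<longrightarrow> R e f \<longrightarrow> col e \<noteq> col f)"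
    by (rule greedy_colouring[OF E]) (erule sym, erule few)
  then obtain col where col: "\<forall>e\<in>E. col e < 2 * B"
    "\<forall>e\<in>E. \<forall>f\<in>E. e \<noteq> f \<longrightarrow> R e f \<longrightarrow> col e \<noteq> col f"
    by (elim exE conjE) (rule that)
  define c' where "c' = (\<lambda>e. (c e)(k := col e))"
  \<comment> \<open>Stages up to \<open>k\<close> read \<open>c\<close> only below \<open>k\<close>,
    so the new coordinate leaves them unchanged.\<close>
  have old: "splice j (c' e) (z e) = splice j (c e) (z e)" if "j \<le> k" for j e and z :: "'e \<Rightarrow> nat \<Rightarrow> nat"
    using that by (auto simp: splice_def c'_def fun_eq_iff)
  \<comment> \<open>Two edges that coincide at stage \<open>Suc k\<close> agree outside coordinate
    \<open>k\<close> at stage \<open>k\<close>. They are then in conflict, so their colours, which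
    are now the values in coordinate \<open>k\<close>, differ.\<close>
  have new: "separating D E (\<lambda>e. splice (Suc k) (c' e) (z e))"
    if z: "z = x \<or> z = y" for z
    unfolding separating_def
  proof (intro ballI impI, rule ccontr)
    fix e f assume ef: "e \<in> E" "f \<in> E" "e \<noteq> f"
      and "\<not> (\<exists>i<D. splice (Suc k) (c' e) (z e) i \<noteq> splice (Suc k) (c' f) (z f) i)"
    then have eq: "splice (Suc k) (c' e) (z e) i = splice (Suc k) (c' f) (z f) i" if "i < D" for i
      using that by blast
    have "splice k (c e) (z e) i = splice k (c f) (z f) i" if "i < D" "i \<noteq> k" for i
      using eq[OF that(1)] that(2) by (auto simp: splice_def c'_def less_Suc_eq split: if_split_asm)
    then have "R e f" using z by (auto simp: R_def P_def)
    then have "col e \<noteq> col f" using col ef by blast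
    then show False using eq[of k] Suc.prems by (simp add: splice_def c'_def)
  qed
  have "separating D E (\<lambda>e. splice j (c' e) (x e)) \<and> separating D E (\<lambda>e. splice j (c' e) (y e))"
    if "j \<le> Suc k" for j
    using that new sep old by (cases "j = Suc k") auto
  moreover have "\<forall>e\<in>E. \<forall>i<Suc k. c' e i < 2 * B"
    using c col by (auto simp: c'_def less_Suc_eq)
  ultimately show ?case by blast
qed

text \<open>
  Coordinate \<open>D\<close> is the direction orthogonal to the face of the vertices. Steps alternate: from
  \<open>2 * k\<close> to \<open>2 * k + 1\<close> only coordinate \<open>D\<close> changes, to \<open>c k + 1\<close>; from \<open>2 * k + 1\<close> to \<open>2 * k + 2\<close>
  only coordinate \<open>k\<close> changes, from \<open>x k\<close> to \<open>c k\<close>. The successor keeps the intermediate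
  waypoints off the face, where coordinate \<open>D\<close> is \<open>0\<close>.
\<close>

definition waypoint :: "nat \<Rightarrow> (nat \<Rightarrow> nat) \<Rightarrow> (nat \<Rightarrow> nat) \<Rightarrow> nat \<Rightarrow> nat \<Rightarrow> nat" where
  "waypoint D c x j i =
     (if i < D then splice (j div 2) c x i else if j = 0 then 0 else Suc (c ((j - 1) div 2)))"

text \<open>For even \<open>j\<close> only coordinate \<open>D\<close> changes, and stage
  \<open>j div 2\<close> supplies a separating column coordinate. For odd
  \<open>j = 2 * k + 1\<close> let \<open>i\<close> separate stage \<open>Suc k\<close>. If
  \<open>i = k\<close>, the coordinate in motion, then \<open>c e k\<close> and \<open>c f k\<close>
  differ, and so do the levels on which the two moves run.\<close>

lemma waypoint_move:
  assumes c: "\<And>k. k \<le> D \<Longrightarrow> separating D E (\<lambda>e. splice k (c e) (x e))"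
    and ef: "e \<in> E" "f \<in> E" "e \<noteq> f" and j: "j < 2 * D"
  shows "\<exists>i\<le>D. waypoint D (c e) (x e) j i = waypoint D (c e) (x e) (Suc j) i \<and>
    waypoint D (c f) (x f) j i = waypoint D (c f) (x f) (Suc j) i \<and>
    waypoint D (c e) (x e) j i \<noteq> waypoint D (c f) (x f) j i"
proof (cases "even j")
  case True
  then obtain k where k: "j = 2 * k" by blast
  then obtain i where "i < D" "splice k (c e) (x e) i \<noteq> splice k (c f) (x f) i"
    using c[of k] ef j unfolding separating_def by auto
  then show ?thesis using k by (intro exI[of _ i]) (simp add: waypoint_def)
next
  case False
  then obtain k where k: "j = 2 * k + 1" by (rule oddE)
  have "Suc k \<le> D" using j k by simp
  then obtain i where i: "i < D" "splice (Suc k) (c e) (x e) i \<noteq> splice (Suc k) (c f) (x f) i"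
    using c[of "Suc k"] ef unfolding separating_def by blast
  show ?thesis
  proof (cases "i = k")
    case True
    then show ?thesis using k i by (intro exI[of _ D]) (simp add: waypoint_def splice_def)
  next
    case False
    then show ?thesis using k i by (intro exI[of _ i]) (auto simp: waypoint_def splice_def less_Suc_eq)
  qed
qed

section \<open>Piecewise linear paths with moves and rests\<close>

definition ramp :: "real \<Rightarrow> real" where
  "ramp s = max 0 (min 1 s)"

text \<open>
  Moves take place on \<open>[2j, 2j + 1]\<close> and rests on \<open>[2j + 1, 2j + 2]\<close>. Because of the rests, any two
  times less than \<open>1\<close> apart belong to the same move and the adjacent rests (\<open>common_window\<close>).
\<close>

definition staircase :: "nat \<Rightarrow> (nat \<Rightarrow> real) \<Rightarrow> real \<Rightarrow> real" where
  "staircase n p t = p 0 + (\<Sum>j<n. ramp (t - 2 * real j) * (p (Suc j) - p j))"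

lemma continuous_on_staircase [continuous_intros]:
  "continuous_on A f \<Longrightarrow> continuous_on A (\<lambda>t. staircase n p (f t))"
  unfolding staircase_def ramp_def by (intro continuous_intros)

text \<open>The moves before \<open>j\<close> are complete and telescope to
  \<open>p j - p 0\<close>; those after \<open>j\<close> have not begun.\<close>

lemma staircase_eq:
  assumes j: "j < n" and t: "2 * real j \<le> t" "t \<le> 2 * real j + 2"
  shows "staircase n p t = p j + ramp (t - 2 * real j) * (p (Suc j) - p j)"
proof -
  let ?f = "\<lambda>i. ramp (t - 2 * real i) * (p (Suc i) - p i)"
  have "{..<n} = ({..<j} \<union> {j}) \<union> {Suc j..<n}" using j by auto
  then have "(\<Sum>i<n. ?f i) = (\<Sum>i\<in>({..<j} \<union> {j}) \<union> {Suc j..<n}. ?f i)"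
    by (rule arg_cong)
  also have "\<dots> = (\<Sum>i\<in>{..<j} \<union> {j}. ?f i) + (\<Sum>i\<in>{Suc j..<n}. ?f i)"
    by (rule sum.union_disjoint) auto
  also have "(\<Sum>i\<in>{Suc j..<n}. ?f i) = 0"
  proof (rule sum.neutral, intro ballI)
    fix i assume "i \<in> {Suc j..<n}"
    then have "real i \<ge> real j + 1" by simp
    then show "?f i = 0" using t by (simp add: ramp_def)
  qed
  also have "(\<Sum>i\<in>{..<j} \<union> {j}. ?f i) = (\<Sum>i<j. ?f i) + ?f j"
    by (simp add: add.commute)
  also have "(\<Sum>i<j. ?f i) = (\<Sum>i<j. p (Suc i) - p i)"
  proof (rule sum.cong[OF refl])
    fix i assume "i \<in> {..<j}"
    then have "real i + 1 \<le> real j" by simp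
    then have "ramp (t - 2 * real i) = 1" using t by (simp add: ramp_def)
    then show "?f i = p (Suc i) - p i" by simp
  qed
  also have "\<dots> = p j - p 0" by (rule sum_lessThan_telescope)
  finally show ?thesis by (simp add: staircase_def)
qed

text \<open>Before time \<open>2 * j\<close> the path rests after move \<open>j - 1\<close>. For
  \<open>j = 0\<close> there is no such rest, whence the bound \<open>0 \<le> t\<close>.\<close>

lemma staircase_const:
  assumes j: "j < n" and t: "0 \<le> t" "2 * real j - 1 \<le> t" "t \<le> 2 * real j + 2" and p: "p j = p (Suc j)"
  shows "staircase n p t = p j"
proof (cases "2 * real j \<le> t")
  case True
  then show ?thesis using staircase_eq[OF j True t(3)] p by simp
next
  case False
  then obtain i where i: "j = Suc i" using t by (cases j) auto
  have "ramp (t - 2 * real i) = 1" using t i by (simp add: ramp_def)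
  then show ?thesis using staircase_eq[of i n t p] i j t False by simp
qed

text \<open>At each time the path is a convex combination of two consecutive waypoints.\<close>

lemma staircase_bounds:
  assumes t: "2 * real a \<le> t" "t < 2 * real b" "b \<le> n" and p: "\<And>j. a \<le> j \<Longrightarrow> j \<le> b \<Longrightarrow> lo \<le> p j \<and> p j \<le> hi"
  shows "lo \<le> staircase n p t \<and> staircase n p t \<le> hi"
proof -
  define j where "j = nat \<lfloor>t / 2\<rfloor>"
  have j: "2 * real j \<le> t" "t < 2 * real j + 2" using t unfolding j_def by linarith+
  then have ab: "a \<le> j" "j < b" using t by linarith+
  define s where "s = ramp (t - 2 * real j)"
  have s: "0 \<le> s" "0 \<le> 1 - s" by (auto simp: s_def ramp_def)
  have "staircase n p t = (1 - s) * p j + s * p (Suc j)"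
    using staircase_eq[of j n t p] j ab t by (simp add: s_def algebra_simps)
  moreover have "(1 - s) * p j + s * p (Suc j) \<le> (1 - s) * hi + s * hi"
    using s p[of j] p[of "Suc j"] ab by (intro add_mono mult_left_mono) auto
  moreover have "(1 - s) * lo + s * lo \<le> (1 - s) * p j + s * p (Suc j)"
    using s p[of j] p[of "Suc j"] ab by (intro add_mono mult_left_mono) auto
  ultimately show ?thesis by (simp add: algebra_simps)
qed

lemma common_window:
  assumes n: "0 < n" and t: "0 \<le> t" "t \<le> 2 * real n - 1" and t': "0 \<le> t'" "t' \<le> 2 * real n - 1"
    and d: "\<bar>t - t'\<bar> < 1"
  shows "\<exists>j<n. {t, t'} \<subseteq> {2 * real j - 1..2 * real j + 2}"
proof -
  define s where "s = min t t'"
  have s: "0 \<le> s" "s \<le> t" "s \<le> t'" "t < s + 1" "t' < s + 1" using t t' d by (auto simp: s_def)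
  \<comment> \<open>With this choice \<open>2 * k - 1 \<le> s\<close> and
    \<open>s + 1 < 2 * k + 2\<close>, so window \<open>k\<close> contains both times. If
    \<open>k\<close> is not below \<open>n\<close>, both times equal \<open>2 * n - 1\<close>, which
    lies in the last window.\<close>
  define k where "k = nat \<lfloor>(s + 1) / 2\<rfloor>"
  have k: "2 * real k \<le> s + 1" "s + 1 < 2 * real k + 2"
  proof -
    have "real k = of_int \<lfloor>(s + 1) / 2\<rfloor>" using s(1) by (simp add: k_def)
    then have "real k \<le> (s + 1) / 2" "(s + 1) / 2 < real k + 1"
      using floor_correct[of "(s + 1) / 2"] by simp_all
    then show "2 * real k \<le> s + 1" "s + 1 < 2 * real k + 2" by simp_all
  qed
  show ?thesis
  proof (cases "k < n")
    case True
    then show ?thesis using k s by (intro exI[of _ k]) auto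
  next
    case False
    then have "real n \<le> real k" by simp
    then have "t = 2 * real n - 1" "t' = 2 * real n - 1" using k s t t' by linarith+
    then show ?thesis using n by (intro exI[of _ "n - 1"]) (auto simp: of_nat_diff)
  qed
qed

section \<open>Distance and volume in the chart\<close>

lemma RH_dist_le:
  assumes "L \<in> curve_lengths r q a b" "a \<in> RH_carrier r q" "b \<in> RH_carrier r q"
  shows "RH_dist r q a b \<le> L"
  using assms by (simp add: RH_dist_def cInf_lower bdd_below_curve_lengths)

text \<open>By \<open>curve_lengths_lower_bound\<close>, a curve shorter than \<open>1\<close> moves
  coordinate \<open>i\<close> by less than the assumed displacement. Only the height of the first
  point enters this bound.\<close>

lemma RH_dist_ge_one:
  assumes a: "a \<in> RH_carrier r q" and b: "b \<in> RH_carrier r q" and i: "i < r + q"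
    and ab: "max 1 (exp 1 * a (r + q - 1)) \<le> \<bar>b i - a i\<bar>"
  shows "1 \<le> RH_dist r q a b"
proof -
  let ?K = "max 1 (exp 1 * a (r + q - 1))"
  have "1 \<le> L" if "L \<in> curve_lengths r q a b" for L
  proof (rule ccontr)
    assume L: "\<not> 1 \<le> L"
    then have "?K * L < ?K * 1" by (intro mult_strict_left_mono) auto
    then show False using curve_lengths_lower_bound[OF that i] ab L by linarith
  qed
  then show ?thesis
    using curve_lengths_nonempty[OF a b] a b by (auto simp: RH_dist_def intro!: cInf_greatest)
qed

lemma sqrt_sum_squares_le: "finite A \<Longrightarrow> sqrt (\<Sum>i\<in>A. (f i)\<^sup>2) \<le> (\<Sum>i\<in>A. \<bar>f i :: real\<bar>)"
  using L2_set_le_sum_abs[of f A] by (simp add: L2_set_def)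

text \<open>The straight segment stays at height at least \<open>1\<close>, where no metric
  coefficient exceeds \<open>1\<close>. Its length is at most the Euclidean one, hence at most the
  sum of the coordinate differences.\<close>

lemma RH_dist_le_sum:
  assumes a: "a \<in> RH_carrier r q" and b: "b \<in> RH_carrier r q" and n: "0 < r + q"
    and ha: "1 \<le> a (r + q - 1)" and hb: "1 \<le> b (r + q - 1)"
  shows "RH_dist r q a b \<le> (\<Sum>i<r + q. \<bar>a i - b i\<bar>)"
proof -
  define \<gamma> where "\<gamma> = (\<lambda>t::real. \<lambda>i. if i < r + q then (1 - t) * a i + t * b i else undefined)"
  have h: "1 \<le> \<gamma> t (r + q - 1)" if "t \<in> {0..1}" for t
  proof -
    have "(1 - t) * 1 + t * 1 \<le> (1 - t) * a (r + q - 1) + t * b (r + q - 1)"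
      using that ha hb by (intro add_mono mult_left_mono) auto
    then show ?thesis using n by (simp add: \<gamma>_def)
  qed
  have ends: "\<gamma> 0 = a" "\<gamma> 1 = b"
    using a b by (auto simp: \<gamma>_def RH_carrier_def PiE_def extensional_def)
  have car: "\<gamma> t \<in> RH_carrier r q" if "t \<in> {0..1}" for t
    using h[OF that] by (auto simp: RH_carrier_def \<gamma>_def PiE_def extensional_def)
  have vd: "((\<lambda>s. \<gamma> s i) has_vector_derivative b i - a i) (at t)" if "i < r + q" for i t
    using that unfolding \<gamma>_def
    by (auto intro!: derivative_eq_intros simp: has_real_derivative_iff_has_vector_derivative[symmetric])
  have vp: "valid_path (\<lambda>t. \<gamma> t i)" if "i < r + q" for i
  proof -
    have "(\<lambda>t. \<gamma> t i) = linepath (a i) (b i)"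
      using that by (auto simp: \<gamma>_def linepath_def)
    then show ?thesis by (simp only: valid_path_linepath)
  qed
  have sp: "speed r q \<gamma> = (\<lambda>t. sqrt (\<Sum>i<r + q. metric_coeff r q (\<gamma> t) i * (b i - a i)\<^sup>2))"
    unfolding speed_def by (intro ext arg_cong[where f=sqrt] sum.cong refl) (simp add: vector_derivative_at[OF vd])
  have "continuous_on {0..1} (\<lambda>t. metric_coeff r q (\<gamma> t) i)" for i
  proof -
    have "continuous_on {0..1} (\<lambda>t. \<gamma> t (r + q - 1))"
      using n unfolding \<gamma>_def by (auto intro!: continuous_intros)
    moreover have "\<gamma> t (r + q - 1) \<noteq> 0" if "t \<in> {0..1}" for t using h[OF that] by simp
    ultimately show ?thesis
      unfolding metric_coeff_def by (cases "i < r") (auto intro!: continuous_intros)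
  qed
  then have "speed r q \<gamma> integrable_on {0..1}"
    unfolding sp by (intro integrable_continuous_real continuous_intros)
  then have int: "(speed r q \<gamma> has_integral integral {0..1} (speed r q \<gamma>)) {0..1}"
    by (rule integrable_integral)
  have "speed r q \<gamma> t \<le> (\<Sum>i<r + q. \<bar>a i - b i\<bar>)" if t: "t \<in> {0..1}" for t
  proof -
    have "metric_coeff r q (\<gamma> t) i * (b i - a i)\<^sup>2 \<le> 1 * (a i - b i)\<^sup>2" for i
      unfolding power2_commute[of "a i"] metric_coeff_def using h[OF t]
      by (intro mult_right_mono) (auto simp: divide_le_eq_1)
    then have "speed r q \<gamma> t \<le> sqrt (\<Sum>i<r + q. (a i - b i)\<^sup>2)"
      unfolding sp by (intro real_sqrt_le_mono sum_mono) simp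
    also have "\<dots> \<le> (\<Sum>i<r + q. \<bar>a i - b i\<bar>)" by (rule sqrt_sum_squares_le) simp
    finally show ?thesis .
  qed
  then have "integral {0..1} (speed r q \<gamma>) \<le> (\<Sum>i<r + q. \<bar>a i - b i\<bar>)"
    using has_integral_le[OF int has_integral_const_real[of "\<Sum>i<r + q. \<bar>a i - b i\<bar>" 0 1]] by simp
  moreover have "integral {0..1} (speed r q \<gamma>) \<in> curve_lengths r q a b"
    using ends car vp int unfolding curve_lengths_def by blast
  ultimately show ?thesis using RH_dist_le[OF _ a b] by fastforce
qed

lemma continuous_map_RH:
  assumes car: "\<And>t. t \<in> S \<Longrightarrow> \<gamma> t \<in> RH_carrier r q" and n: "0 < r + q"
    and h: "\<And>t. t \<in> S \<Longrightarrow> 1 \<le> \<gamma> t (r + q - 1)"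
    and cont: "\<And>i. i < r + q \<Longrightarrow> continuous_on S (\<lambda>t. \<gamma> t i)"
  shows "continuous_map (top_of_set S) (mtopology_of (RH_metric r q)) \<gamma>"
proof -
  interpret Metric_space "RH_carrier r q" "RH_dist r q" by (rule Metric_space_RH)
  have "\<exists>U. openin (top_of_set S) U \<and> s \<in> U \<and> (\<forall>t\<in>U. \<gamma> t \<in> mball (\<gamma> s) \<epsilon>)"
    if s: "s \<in> S" and \<epsilon>: "0 < \<epsilon>" for s \<epsilon>
  proof (intro exI conjI ballI)
    let ?f = "\<lambda>t. \<Sum>i<r + q. \<bar>\<gamma> s i - \<gamma> t i\<bar>"
    let ?U = "S \<inter> ?f -` {..<\<epsilon>}"
    have "continuous_on S ?f" using cont by (intro continuous_intros) auto
    then show "openin (top_of_set S) ?U" by (rule continuous_openin_preimage_gen) simp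
    show "s \<in> ?U" using s \<epsilon> by simp
    show "\<gamma> t \<in> mball (\<gamma> s) \<epsilon>" if "t \<in> ?U" for t
      using that s car h RH_dist_le_sum[OF car car n h h, of s t] by (auto simp: in_mball)
  qed
  then show ?thesis
    by (simp add: mtopology_of_def mspace_RH_metric mdist_RH_metric continuous_map_to_metric)
qed

text \<open>The logarithm of the height changes by at most the length of the curve, so the height
  stays below \<open>exp R\<close> times its initial value, and this factor converts length into
  coordinate displacement. A general \<open>R\<close> is allowed because an infimum equal to
  \<open>1\<close> only yields curves of length slightly above \<open>1\<close>.\<close>

lemma RH_displacement:
  assumes L: "L \<in> curve_lengths r q a b" and LR: "L \<le> R" and q: "0 < q"
  shows "\<bar>ln (b (r + q - 1)) - ln (a (r + q - 1))\<bar> \<le> L"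
    and "i < r + q \<Longrightarrow> \<bar>b i - a i\<bar> \<le> max 1 (exp R * a (r + q - 1)) * L"
proof -
  let ?h = "r + q - 1"
  obtain \<gamma> where car: "\<And>t. t \<in> {0..1} \<Longrightarrow> \<gamma> t \<in> RH_carrier r q"
    and vp: "\<And>i. i < r + q \<Longrightarrow> valid_path (\<lambda>t. \<gamma> t i)" and ends: "\<gamma> 0 = a" "\<gamma> 1 = b"
    and int: "(speed r q \<gamma> has_integral L) {0..1}"
    using L unfolding curve_lengths_def by blast
  obtain S where S: "finite S"
    "\<And>i t. \<lbrakk>i < r + q; t \<in> {0..1} - S\<rbrakk> \<Longrightarrow> (\<lambda>t. \<gamma> t i) differentiable (at t)"
    using valid_path_differentiable[of "r + q" \<gamma>] vp by blast
  define D where "D = (\<lambda>i t. vector_derivative (\<lambda>s. \<gamma> s i) (at t))"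
  have D: "((\<lambda>t. \<gamma> t i) has_vector_derivative D i t) (at t)" if "i < r + q" "t \<in> {0..1} - S" for i t
    using S(2) that by (simp add: D_def vector_derivative_works[symmetric])
  have cont: "continuous_on {0..1} (\<lambda>t. \<gamma> t i)" if "i < r + q" for i
    using vp[OF that] by (simp add: valid_path_def piecewise_C1_differentiable_on_def)
  have h: "0 < \<gamma> t ?h" if "t \<in> {0..1}" for t
    using RH_carrierD[OF car[OF that]] .
  have lt: "\<not> ?h < r" "?h < r + q" using q by auto
  have comp: "\<bar>D i t\<bar> \<le> (if i < r then 1 else \<gamma> t ?h) * speed r q \<gamma> t"
    if "i < r + q" "t \<in> {0..1}" for i t
    using speed_ge_component[of i r q \<gamma> t] that h[of t]
    by (auto simp: D_def metric_coeff_def real_sqrt_divide field_simps)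
  have log: "\<bar>ln (\<gamma> \<tau> ?h) - ln (\<gamma> 0 ?h)\<bar> \<le> 1 * L" if \<tau>: "\<tau> \<in> {0..1}" for \<tau>
  proof (rule displacement_le_length[OF int speed_nonneg S(1)])
    show "continuous_on {0..1} (\<lambda>t. ln (\<gamma> t ?h))"
      using h cont[OF lt(2)] by (intro continuous_on_ln) force+
    show "((\<lambda>t. ln (\<gamma> t ?h)) has_vector_derivative D ?h t / \<gamma> t ?h) (at t)" if "t \<in> {0..1} - S" for t
      using D[OF lt(2) that] h[of t] that
      by (auto simp: has_real_derivative_iff_has_vector_derivative[symmetric] intro!: derivative_eq_intros)
    show "\<bar>D ?h t / \<gamma> t ?h\<bar> \<le> 1 * speed r q \<gamma> t" if "t \<in> {0..1} - S" for t
      using comp[OF lt(2), of t] lt h[of t] that by (simp add: field_simps)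
  qed (use \<tau> in auto)
  from log[of 1] show "\<bar>ln (b ?h) - ln (a ?h)\<bar> \<le> L" using ends by simp
  have height: "\<gamma> \<tau> ?h \<le> exp R * a ?h" if \<tau>: "\<tau> \<in> {0..1}" for \<tau>
  proof -
    have "ln (\<gamma> \<tau> ?h) \<le> R + ln (a ?h)" using log[OF \<tau>] LR ends(1) by simp
    then have "exp (ln (\<gamma> \<tau> ?h)) \<le> exp (R + ln (a ?h))" by simp
    then show ?thesis using h[OF \<tau>] h[of 0] ends by (simp add: exp_add)
  qed
  show "\<bar>b i - a i\<bar> \<le> max 1 (exp R * a ?h) * L" if i: "i < r + q"
  proof -
    have "\<bar>\<gamma> 1 i - \<gamma> 0 i\<bar> \<le> max 1 (exp R * a ?h) * L"
    proof (rule displacement_le_length[OF int speed_nonneg S(1) cont[OF i] D[OF i]])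
      show "\<bar>D i t\<bar> \<le> max 1 (exp R * a ?h) * speed r q \<gamma> t" if "t \<in> {0..1} - S" for t
        by (rule order_trans[OF comp[OF i]], use that in simp, rule mult_right_mono[OF _ speed_nonneg])
          (use that height[of t] in auto)
    qed auto
    then show ?thesis using ends by simp
  qed
qed

lemma RH_dist_le_oneD:
  assumes a: "a \<in> RH_carrier r q" and b: "b \<in> RH_carrier r q" and q: "0 < q"
    and d: "RH_dist r q a b \<le> 1" and ha: "1 \<le> a (r + q - 1)"
  shows "exp (- 2) \<le> b (r + q - 1)" and "i < r + q \<Longrightarrow> \<bar>b i - a i\<bar> \<le> exp 2 * a (r + q - 1) * 2"
proof -
  \<comment> \<open>The infimum is used through a curve of length at most \<open>2\<close>, whence
    the constants \<open>exp 2\<close> and \<open>2\<close>.\<close>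
  have "Inf (curve_lengths r q a b) < 2" using a b d by (simp add: RH_dist_def)
  then obtain L where L: "L \<in> curve_lengths r q a b" "L \<le> 2"
    using cInf_lessD[OF curve_lengths_nonempty[OF a b]] by force
  have "0 \<le> ln (a (r + q - 1))" using ha by simp
  with RH_displacement(1)[OF L q] L have "- 2 \<le> ln (b (r + q - 1))" by linarith
  then show "exp (- 2) \<le> b (r + q - 1)"
    using RH_carrierD[OF b] by (simp add: ln_ge_iff)
  have "1 * 1 \<le> exp (2::real) * a (r + q - 1)" using ha by (intro mult_mono) auto
  then show "\<bar>b i - a i\<bar> \<le> exp 2 * a (r + q - 1) * 2" if "i < r + q"
    using RH_displacement(2)[OF L q that] mult_left_mono[OF L(2), of "exp 2 * a (r + q - 1)"]
    by (simp only: max.absorb2) linarith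
qed

text \<open>At height at least \<open>exp (- 2)\<close> each metric coefficient is at most
  \<open>(exp 2)^2\<close>, so the density is at most \<open>exp 2 ^ (r + q)\<close>; what remains
  is the Lebesgue measure of an enclosing box.\<close>

lemma RH_volume_box:
  assumes q: "0 < q" and M: "0 \<le> M" and H: "0 \<le> H"
    and A: "\<And>z. z \<in> A \<Longrightarrow> z \<in> RH_carrier r q \<and> (\<forall>i<r + q - 1. \<bar>z i\<bar> \<le> M) \<and>
      exp (- 2) \<le> z (r + q - 1) \<and> z (r + q - 1) \<le> H"
  shows "emeasure (RH_volume r q) A \<le> ennreal (exp 2 ^ (r + q) * ((2 * M) ^ (r + q - 1) * H))"
proof -
  let ?n = "r + q" and ?h = "r + q - 1"
  let ?P = "\<Pi>\<^sub>M i\<in>{..<?n}. (lborel :: real measure)"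
  define I where "I = (\<lambda>i. if i = ?h then {exp (- 2)..H} else {- M..M})"
  define Q where "Q = (\<Pi>\<^sub>E i\<in>{..<?n}. I i)"
  define w where "w = (\<lambda>p. ennreal (sqrt (\<Prod>i<?n. metric_coeff r q p i)))"
  have hn: "?h < ?n" using q by simp
  have Qs: "Q \<in> sets ?P" unfolding Q_def by (rule sets_PiM_I_finite) (auto simp: I_def)
  have QC: "Q \<subseteq> RH_carrier r q"
  proof
    fix z assume z: "z \<in> Q"
    then have "z ?h \<in> I ?h" using hn unfolding Q_def by blast
    then have "exp (- 2) \<le> z ?h" by (simp add: I_def)
    then have "0 < z ?h" by (rule less_le_trans[OF exp_gt_zero])
    then show "z \<in> RH_carrier r q" using z by (auto simp: RH_carrier_def Q_def PiE_def)
  qed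
  have AQ: "A \<subseteq> Q"
  proof
    fix z assume z: "z \<in> A"
    have "z i \<in> I i" if "i < ?n" for i
    proof (cases "i = ?h")
      case False
      then have "\<bar>z i\<bar> \<le> M" using A[OF z] that by simp
      then show ?thesis using False by (auto simp: I_def abs_le_iff)
    qed (use A[OF z] in \<open>simp add: I_def\<close>)
    then show "z \<in> Q" using A[OF z] by (auto simp: Q_def RH_carrier_def PiE_def)
  qed
  have comp: "(\<lambda>p. p i) \<in> borel_measurable ?P" if "i < ?n" for i
    using measurable_component_singleton[of i "{..<?n}" "\<lambda>_. lborel"] that by simp
  have "RH_carrier r q = (\<lambda>p. p ?h) -` {0<..} \<inter> space ?P"
    by (auto simp: RH_carrier_def space_PiM)
  also have "\<dots> \<in> sets ?P" using comp[OF hn] by (rule measurable_sets) simp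
  finally have Cs: "RH_carrier r q \<in> sets ?P" .
  have "(\<lambda>p. metric_coeff r q p i) \<in> borel_measurable ?P" for i
    unfolding metric_coeff_def using comp[OF hn] by measurable
  then have "w \<in> borel_measurable ?P" unfolding w_def by measurable
  then have wm: "w \<in> borel_measurable (restrict_space ?P (RH_carrier r q))"
    by (rule measurable_restrict_space1)
  have Qr: "Q \<in> sets (restrict_space ?P (RH_carrier r q))"
    using Qs QC Cs by (auto simp: sets_restrict_space_iff)
  have wle: "w p \<le> ennreal (exp 2 ^ ?n)" if "p \<in> Q" for p
  proof -
    have "p ?h \<in> I ?h" using hn that unfolding Q_def by blast
    then have ph: "exp (- 2) \<le> p ?h" by (simp add: I_def)
    have "metric_coeff r q p i \<le> (exp 2)\<^sup>2" for i
    proof (cases "i < r")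
      case True
      have "(1::real) \<le> (exp 2)\<^sup>2" by (intro one_le_power) simp
      then show ?thesis using True by (simp add: metric_coeff_def)
    next
      case False
      have "1 / (p ?h)\<^sup>2 \<le> 1 / (exp (- 2))\<^sup>2"
        using ph less_le_trans[OF exp_gt_zero ph] by (intro divide_left_mono power_mono) auto
      then show ?thesis using False by (simp add: metric_coeff_def exp_minus field_simps)
    qed
    then have "(\<Prod>i<?n. metric_coeff r q p i) \<le> (\<Prod>i<?n. (exp 2)\<^sup>2)"
      by (intro prod_mono) (auto simp: metric_coeff_nonneg)
    also have "\<dots> = (exp 2 ^ ?n)\<^sup>2" by (simp add: power_mult[symmetric] mult.commute)
    finally have "sqrt (\<Prod>i<?n. metric_coeff r q p i) \<le> exp 2 ^ ?n"
      by (rule real_le_lsqrt[rotated]) simp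
    then show ?thesis unfolding w_def by (rule ennreal_leI)
  qed
  interpret product_sigma_finite "\<lambda>_. lborel :: real measure" ..
  have "emeasure (RH_volume r q) A \<le> emeasure (RH_volume r q) Q"
    using Qr by (intro emeasure_mono AQ) (simp add: RH_volume_def)
  also have "\<dots> = (\<integral>\<^sup>+ p. w p * indicator Q p \<partial>restrict_space ?P (RH_carrier r q))"
    unfolding RH_volume_def w_def[symmetric] by (rule emeasure_density[OF wm Qr])
  also have "\<dots> \<le> (\<integral>\<^sup>+ p. ennreal (exp 2 ^ ?n) * indicator Q p \<partial>restrict_space ?P (RH_carrier r q))"
    by (intro nn_integral_mono) (auto simp: indicator_def wle)
  also have "\<dots> = ennreal (exp 2 ^ ?n) * emeasure (restrict_space ?P (RH_carrier r q)) Q"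
    by (rule nn_integral_cmult_indicator[OF Qr])
  also have "emeasure (restrict_space ?P (RH_carrier r q)) Q = emeasure ?P Q"
    using Cs QC by (intro emeasure_restrict_space) auto
  also have "\<dots> = (\<Prod>i<?n. emeasure lborel (I i))"
    unfolding Q_def by (rule emeasure_PiM) (auto simp: I_def)
  also have "{..<?n} = insert ?h {..<?h}" using hn by auto
  also have "(\<Prod>i\<in>insert ?h {..<?h}. emeasure lborel (I i)) = emeasure lborel {exp (- 2)..H} * (\<Prod>i<?h. ennreal (2 * M))"
    using M by (subst prod.insert) (auto simp: I_def intro!: prod.cong)
  also have "\<dots> \<le> ennreal H * (\<Prod>i<?h. ennreal (2 * M))"
    by (intro mult_right_mono) (auto simp: emeasure_lborel_Icc_eq intro!: ennreal_leI)
  also have "\<dots> = ennreal ((2 * M) ^ ?h * H)"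
  proof -
    have "(\<Prod>i<?h. ennreal (2 * M)) = ennreal ((2 * M) ^ ?h)"
      using M by (simp only: prod_constant card_lessThan ennreal_power)
    then show ?thesis using M H ennreal_mult[of H "(2 * M) ^ ?h"] by (simp only: mult.commute[of _ H]) simp
  qed
  finally show ?thesis
    using M H by (simp add: ennreal_mult mult_left_mono)
qed

section \<open>The routed graph\<close>

text \<open>Blocks have side \<open>m\<close>; the ports of \<open>v\<close> are lined up in its
  block along coordinate \<open>0\<close>, one for each incident edge.\<close>

definition port :: "nat \<Rightarrow> ('v \<Rightarrow> nat \<Rightarrow> nat) \<Rightarrow> ('e \<Rightarrow> 'v \<Rightarrow> nat) \<Rightarrow> 'e \<Rightarrow> 'v \<Rightarrow> nat \<Rightarrow> nat" where
  "port m base slot e v i = m * base v i + (if i = 0 then slot e v else 0)"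

text \<open>
  Grid points have the cube coordinates \<open>0, \<dots>, D\<close>; coordinate \<open>D + 1\<close> is half the logarithm of the
  hyperbolic height.
\<close>

definition apart :: "nat \<Rightarrow> (nat \<Rightarrow> real) \<Rightarrow> (nat \<Rightarrow> real) \<Rightarrow> bool" where
  "apart D x y \<longleftrightarrow> (\<exists>i\<le>Suc D. 1 \<le> \<bar>x i - y i\<bar>)"

lemma apart_sym: "apart D x y \<Longrightarrow> apart D y x"
  by (auto simp: apart_def abs_minus_commute)

lemma apartI: "1 \<le> \<bar>x i - y i\<bar> \<Longrightarrow> i \<le> Suc D \<Longrightarrow> apart D x y"
  by (auto simp: apart_def)

lemma apart_neq: "apart D x y \<Longrightarrow> \<exists>i\<le>Suc D. x i \<noteq> y i"
  by (force simp: apart_def)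

text \<open>Here \<open>m\<close> is the side of a block and \<open>B\<close> that of the face. The
  intermediate points use \<open>2 * B\<close> values because the greedy choice has to avoid two
  lines, one for each end.\<close>

locale routed_graph =
  fixes V :: "'v set" and E :: "'v set set" and D m B :: nat
    and src tgt :: "'v set \<Rightarrow> 'v" and base :: "'v \<Rightarrow> nat \<Rightarrow> nat"
    and slot :: "'v set \<Rightarrow> 'v \<Rightarrow> nat" and c :: "'v set \<Rightarrow> nat \<Rightarrow> nat"
  assumes D: "0 < D" and m: "0 < m" and finite_V: "finite V"
    and edge: "e \<in> E \<Longrightarrow> e = {src e, tgt e} \<and> src e \<noteq> tgt e \<and> src e \<in> V \<and> tgt e \<in> V"
    and base_neq: "v \<in> V \<Longrightarrow> w \<in> V \<Longrightarrow> v \<noteq> w \<Longrightarrow> \<exists>i<D. base v i \<noteq> base w i"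
    and base_bound: "v \<in> V \<Longrightarrow> i < D \<Longrightarrow> m * base v i + m \<le> B"
    and slot_less: "e \<in> E \<Longrightarrow> v \<in> e \<Longrightarrow> slot e v < m"
    and slot_neq: "e \<in> E \<Longrightarrow> f \<in> E \<Longrightarrow> v \<in> e \<Longrightarrow> v \<in> f \<Longrightarrow> e \<noteq> f \<Longrightarrow> slot e v \<noteq> slot f v"
    and c_less: "e \<in> E \<Longrightarrow> i < D \<Longrightarrow> c e i < 2 * B"
    and separating_src: "k \<le> D \<Longrightarrow> separating D E (\<lambda>e. splice k (c e) (port m base slot e (src e)))"
    and separating_tgt: "k \<le> D \<Longrightarrow> separating D E (\<lambda>e. splice k (c e) (port m base slot e (tgt e)))"
begin

abbreviation P :: "'v set \<Rightarrow> 'v \<Rightarrow> nat \<Rightarrow> nat" where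
  "P \<equiv> port m base slot"

text \<open>The second half is the route of the target run backwards; the halves meet at step
  \<open>2 * D\<close> in the intermediate point.\<close>

definition way :: "'v set \<Rightarrow> nat \<Rightarrow> nat \<Rightarrow> nat" where
  "way e j = (if j \<le> 2 * D then waypoint D (c e) (P e (src e)) j
    else waypoint D (c e) (P e (tgt e)) (4 * D - j))"

text \<open>There are \<open>4 * D\<close> moves of duration \<open>1\<close>, each but the last
  followed by a rest of duration \<open>1\<close>.\<close>

definition T :: real where
  "T = 8 * real D - 1"

definition track :: "'v set \<Rightarrow> real \<Rightarrow> nat \<Rightarrow> real" where
  "track e t i = staircase (4 * D) (\<lambda>j. real (way e j i)) t"

definition offset :: "'v set \<Rightarrow> 'v \<Rightarrow> nat \<Rightarrow> real" where
  "offset e v i = (if i = 0 then real (slot e v) else 0)"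

text \<open>
  The edge runs along its track, with the time \<open>w \<in> [0, T]\<close> as coordinate \<open>D + 1\<close>. On \<open>[-1, 0]\<close> and
  \<open>[T, T + 1]\<close> straight segments on the other side of the face lead from the ports to the apex of
  their vertex.
\<close>

definition curve :: "'v set \<Rightarrow> real \<Rightarrow> nat \<Rightarrow> real" where
  "curve e w i =
     (if i < D then track e (max 0 (min T w)) i - max 0 (- w) * offset e (src e) i
        - max 0 (w - T) * offset e (tgt e) i
      else if i = D then track e (max 0 (min T w)) D - max 0 (- w) - max 0 (w - T)
      else max 0 (min T w) - T * max 0 (w - T))"

text \<open>The common end of all edges at \<open>v\<close>, one unit beyond the face. Coordinate
  \<open>D + 1\<close> is \<open>0\<close> whether \<open>v\<close> is a source or a target, which
  is why \<open>curve\<close> comes down from \<open>T\<close> on its last segment.\<close>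

definition apex :: "'v \<Rightarrow> nat \<Rightarrow> real" where
  "apex v i = (if i < D then real (m * base v i) else if i = D then - 1 else 0)"

text \<open>Only column coordinates count, so the block continues on both sides of the face. The
  \<open>- 1\<close> leaves gaps of length at least \<open>1\<close> between distinct
  blocks.\<close>

definition in_block :: "'v \<Rightarrow> (nat \<Rightarrow> real) \<Rightarrow> bool" where
  "in_block v x \<longleftrightarrow> (\<forall>i<D. real (m * base v i) \<le> x i \<and> x i \<le> real (m * base v i) + real m - 1)"

section \<open>Bounds and separation of tracks\<close>

lemma T_ge: "7 \<le> T"
  using D by (simp add: T_def)

lemma edge_ends: "e \<in> E \<Longrightarrow> src e \<in> e" "e \<in> E \<Longrightarrow> tgt e \<in> e"
  using edge[of e] by auto

lemma edge_subset: "e \<in> E \<Longrightarrow> v \<in> e \<Longrightarrow> v \<in> V"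
  using edge[of e] by (metis insertE singletonD)

lemma port_less:
  assumes "e \<in> E" "v \<in> e" "i < D"
  shows "P e v i < B"
  using slot_less[OF assms(1,2)] base_bound[of v i] edge_subset[OF assms(1,2)] assms(3)
  by (auto simp: port_def)

lemma way_src: "j \<le> 2 * D \<Longrightarrow> way e j = waypoint D (c e) (P e (src e)) j"
  by (simp add: way_def)

text \<open>At \<open>j = 2 * D\<close> the formulas of both halves agree: all columns are those of
  \<open>c\<close>, and the level is \<open>Suc (c (D - 1))\<close>.\<close>

lemma way_tgt:
  assumes "2 * D \<le> j" "i \<le> D"
  shows "way e j i = waypoint D (c e) (P e (tgt e)) (4 * D - j) i"
proof (cases "j = 2 * D")
  case True
  then show ?thesis using assms D by (auto simp: way_def waypoint_def splice_def)
qed (use assms in \<open>simp add: way_def\<close>)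

lemma waypoint_bound:
  assumes "e \<in> E" "v \<in> e" "i \<le> D" "j \<le> 2 * D"
  shows "waypoint D (c e) (P e v) j i \<le> 2 * B"
proof (cases "i < D")
  case True
  then show ?thesis using port_less[OF assms(1,2) True] c_less[OF assms(1) True]
    by (simp add: waypoint_def splice_def)
next
  case False
  have "(j - 1) div 2 < D" using D assms(4) by linarith
  then show ?thesis using c_less[OF assms(1)] False by (simp add: waypoint_def Suc_le_eq)
qed

lemma way_bound:
  assumes "e \<in> E" "i \<le> D"
  shows "way e j i \<le> 2 * B"
  using waypoint_bound[OF assms(1) _ assms(2)] edge_ends[OF assms(1)] by (simp add: way_def)

lemma way_height_pos: "0 < j \<Longrightarrow> j < 4 * D \<Longrightarrow> 1 \<le> way e j D"
  by (auto simp: way_def waypoint_def)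

lemma way_ends:
  "way e 0 D = 0"
  "i < D \<Longrightarrow> way e 0 i = P e (src e) i" "i < D \<Longrightarrow> way e (Suc 0) i = P e (src e) i"
  "i < D \<Longrightarrow> way e (4 * D - Suc 0) i = P e (tgt e) i" "i < D \<Longrightarrow> way e (4 * D) i = P e (tgt e) i"
  "way e (4 * D) D = 0"
  using D by (auto simp: way_def waypoint_def splice_def)

lemma way_move:
  assumes ef: "e \<in> E" "f \<in> E" "e \<noteq> f" and j: "j < 4 * D"
  shows "\<exists>i\<le>D. way e j i = way e (Suc j) i \<and> way f j i = way f (Suc j) i \<and> way e j i \<noteq> way f j i"
proof (cases "j < 2 * D")
  case True
  then show ?thesis
    using waypoint_move[where x = "\<lambda>e. P e (src e)", OF separating_src ef True]
    by (simp add: way_src)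
next
  case False
  \<comment> \<open>The move from \<open>j\<close> to \<open>Suc j\<close> is the move from
    \<open>Suc k\<close> to \<open>k\<close> on the target route.\<close>
  define k where "k = 4 * D - Suc j"
  have k: "k < 2 * D" "4 * D - j = Suc k" "4 * D - Suc j = k" using False j by (auto simp: k_def)
  obtain i where "i \<le> D" "waypoint D (c e) (P e (tgt e)) k i = waypoint D (c e) (P e (tgt e)) (Suc k) i"
    "waypoint D (c f) (P f (tgt f)) k i = waypoint D (c f) (P f (tgt f)) (Suc k) i"
    "waypoint D (c e) (P e (tgt e)) k i \<noteq> waypoint D (c f) (P f (tgt f)) k i"
    using waypoint_move[where x = "\<lambda>e. P e (tgt e)", OF separating_tgt ef k(1)] by blast
  then show ?thesis using way_tgt[of j i] way_tgt[of "Suc j" i] False k by (intro exI[of _ i]) auto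
qed

text \<open>Times that differ by \<open>1\<close> or more are separated by coordinate
  \<open>D + 1\<close>, so nearby times remain. In their common window some coordinate is constant
  on both tracks, with distinct integer values.\<close>

lemma track_apart:
  assumes ef: "e \<in> E" "f \<in> E" "e \<noteq> f" and t: "0 \<le> t" "t \<le> T" and t': "0 \<le> t'" "t' \<le> T"
    and near: "\<bar>t - t'\<bar> < 1"
  shows "\<exists>i\<le>D. 1 \<le> \<bar>track e t i - track f t' i\<bar>"
proof -
  have "0 < 4 * D" using D by simp
  from common_window[OF this, of t t'] obtain j where j: "j < 4 * D" "{t, t'} \<subseteq> {2 * real j - 1..2 * real j + 2}"
    using t t' near by (auto simp: T_def)
  obtain i where i: "i \<le> D" "way e j i = way e (Suc j) i" "way f j i = way f (Suc j) i" "way e j i \<noteq> way f j i"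
    using way_move[OF ef j(1)] by blast
  have "track e t i = real (way e j i)" "track f t' i = real (way f j i)"
    unfolding track_def using j t t' i
      staircase_const[of j "4 * D" t "\<lambda>j. real (way e j i)"]
      staircase_const[of j "4 * D" t' "\<lambda>j. real (way f j i)"] by simp_all
  moreover have "1 \<le> \<bar>real (way e j i) - real (way f j i)\<bar>" using i(4) by linarith
  ultimately show ?thesis using i(1) by auto
qed

lemma track_bounds:
  assumes "e \<in> E" "i \<le> D" "0 \<le> t" "t \<le> T"
  shows "0 \<le> track e t i" "track e t i \<le> 2 * real B"
proof -
  have "0 \<le> staircase (4 * D) (\<lambda>j. real (way e j i)) t \<and>
      staircase (4 * D) (\<lambda>j. real (way e j i)) t \<le> real (2 * B)"
    using assms way_bound[OF assms(1,2)]
    by (intro staircase_bounds[of 0 _ "4 * D"] conjI of_nat_0_le_iff of_nat_mono) (auto simp: T_def)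
  then show "0 \<le> track e t i" "track e t i \<le> 2 * real B" by (auto simp: track_def)
qed

text \<open>The first move changes only coordinate \<open>D\<close>, so up to time \<open>1\<close>
  the columns stay at the port.\<close>

lemma track_src: "i < D \<Longrightarrow> 0 \<le> t \<Longrightarrow> t \<le> 1 \<Longrightarrow> track e t i = real (P e (src e) i)"
  unfolding track_def using staircase_const[of 0 "4 * D" t "\<lambda>j. real (way e j i)"] D
  by (simp add: way_ends)

lemma track_tgt:
  assumes "i < D" "T - 1 \<le> t" "t \<le> T"
  shows "track e t i = real (P e (tgt e) i)"
proof -
  have "Suc (4 * D - 1) = 4 * D" "real (4 * D - 1) = 4 * real D - 1" using D by (auto simp: of_nat_diff)
  then show ?thesis
    unfolding track_def using staircase_const[of "4 * D - 1" "4 * D" t "\<lambda>j. real (way e j i)"] D assms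
    by (simp add: way_ends T_def)
qed

lemma track_height_ends: "track e 0 D = 0" "track e T D = 0"
proof -
  show "track e 0 D = 0"
    unfolding track_def using staircase_eq[of 0 "4 * D" 0 "\<lambda>j. real (way e j D)"] D
    by (simp add: way_ends ramp_def)
  have "Suc (4 * D - 1) = 4 * D" "real (4 * D - 1) = 4 * real D - 1" using D by (auto simp: of_nat_diff)
  then show "track e T D = 0"
    unfolding track_def using staircase_eq[of "4 * D - 1" "4 * D" T "\<lambda>j. real (way e j D)"] D
    by (simp add: way_ends ramp_def T_def)
qed

lemma track_height_ge:
  assumes e: "e \<in> E" and t: "1 \<le> t" "t \<le> T - 1"
  shows "1 \<le> track e t D"
proof -
  have way1: "1 \<le> real (way e j D)" if "0 < j" "j < 4 * D" for j
    using way_height_pos[OF that] by simp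
  have D1: "Suc 0 < 4 * D" using D by simp
  have r: "real (4 * D - 1) = 4 * real D - 1" using D by (simp add: of_nat_diff)
  \<comment> \<open>On \<open>[1, 2]\<close> the path rests after the first move. The last move
    starts at \<open>T - 1\<close>, which is treated separately because
    \<open>staircase_bounds\<close> has a strict upper bound.\<close>
  consider "t \<le> 2" | "t = T - 1" | "2 < t" "t < T - 1" using t by linarith
  then show ?thesis
  proof cases
    case 1
    then show ?thesis
      unfolding track_def using staircase_eq[of 0 "4 * D" t "\<lambda>j. real (way e j D)"] D t way1[of 1]
      by (simp add: ramp_def)
  next
    case 2
    then show ?thesis
      unfolding track_def using staircase_eq[of "4 * D - 1" "4 * D" t "\<lambda>j. real (way e j D)"] D way1[of "4 * D - 1"] r
      using D1 by (simp add: ramp_def T_def)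
  next
    case 3
    have "1 \<le> staircase (4 * D) (\<lambda>j. real (way e j D)) t \<and>
      staircase (4 * D) (\<lambda>j. real (way e j D)) t \<le> real (2 * B)"
      using 3 D r way1 way_bound[OF e order_refl]
      by (intro staircase_bounds[of 1 _ "4 * D - 1"] conjI way1 of_nat_mono) (auto simp: T_def)
    then show ?thesis by (simp add: track_def)
  qed
qed

section \<open>Tracks completed by segments to the apexes\<close>

lemma curve_track:
  assumes "0 \<le> w" "w \<le> T"
  shows "i \<le> D \<Longrightarrow> curve e w i = track e w i" and "curve e w (Suc D) = w"
  using assms by (auto simp: curve_def max_def min_def)

lemma port_real: "real (P e v i) = real (m * base v i) + offset e v i"
  by (simp add: port_def offset_def)

lemma curve_src:
  assumes "w \<le> 0"
  shows "i < D \<Longrightarrow> curve e w i = real (m * base (src e) i) + (1 + w) * offset e (src e) i"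
    and "curve e w D = w" and "D < i \<Longrightarrow> curve e w i = 0"
proof -
  have s: "max 0 (min T w) = 0" "max 0 (- w) = - w" "max 0 (w - T) = 0" using assms T_ge by auto
  show "curve e w i = real (m * base (src e) i) + (1 + w) * offset e (src e) i" if "i < D"
    using that s track_src[OF that, of 0 e] by (simp add: curve_def port_real algebra_simps)
  show "curve e w D = w" using s by (simp add: curve_def track_height_ends)
  show "D < i \<Longrightarrow> curve e w i = 0" using s by (simp add: curve_def)
qed

lemma curve_tgt:
  assumes "T \<le> w"
  shows "i < D \<Longrightarrow> curve e w i = real (m * base (tgt e) i) + (1 + (T - w)) * offset e (tgt e) i"
    and "curve e w D = T - w" and "D < i \<Longrightarrow> curve e w i = T * (1 + (T - w))"
proof -
  have s: "max 0 (min T w) = T" "max 0 (- w) = 0" "max 0 (w - T) = w - T" using assms T_ge by auto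
  show "curve e w i = real (m * base (tgt e) i) + (1 + (T - w)) * offset e (tgt e) i" if "i < D"
    using that s track_tgt[OF that, of T e] by (simp add: curve_def port_real algebra_simps)
  show "curve e w D = T - w" using s by (simp add: curve_def track_height_ends)
  show "D < i \<Longrightarrow> curve e w i = T * (1 + (T - w))" using s by (simp add: curve_def algebra_simps)
qed

lemma curve_ends: "curve e (- 1) = apex (src e)" "curve e (T + 1) = apex (tgt e)"
proof -
  have "curve e (- 1) i = apex (src e) i" "curve e (T + 1) i = apex (tgt e) i" for i
    by (cases i D rule: linorder_cases; simp add: apex_def curve_src curve_tgt)+
  then show "curve e (- 1) = apex (src e)" "curve e (T + 1) = apex (tgt e)" by auto
qed

lemma block_apart:
  assumes "v \<in> V" "w \<in> V" "v \<noteq> w" and x: "in_block v x" and y: "in_block w y"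
  shows "apart D x y"
proof -
  obtain i where i: "i < D" "base v i \<noteq> base w i" using base_neq assms by blast
  have xi: "real (m * base v i) \<le> x i" "x i \<le> real (m * base v i) + real m - 1"
    and yi: "real (m * base w i) \<le> y i" "y i \<le> real (m * base w i) + real m - 1"
    using x y i(1) unfolding in_block_def by blast+
  have *: "real (m * a) + real m \<le> real (m * b)" if "a < b" for a b
  proof -
    have "m * Suc a \<le> m * b" using that by (intro mult_le_mono2) simp
    then have "real (m * Suc a) \<le> real (m * b)" by (rule of_nat_mono)
    then show ?thesis by (simp add: algebra_simps)
  qed
  have "1 \<le> \<bar>x i - y i\<bar>"
    using *[of "base v i" "base w i"] *[of "base w i" "base v i"] i(2) xi yi
    by (cases "base v i < base w i") linarith+
  then show ?thesis using i(1) by (intro apartI[of _ i]) auto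
qed

lemma in_blockI:
  assumes e: "e \<in> E" "v \<in> e" and s: "0 \<le> s" "s \<le> 1"
    and x: "\<And>i. i < D \<Longrightarrow> x i = real (m * base v i) + s * offset e v i"
  shows "in_block v x"
  unfolding in_block_def
proof (intro allI impI)
  fix i assume i: "i < D"
  have off: "0 \<le> offset e v i" "offset e v i \<le> real m - 1"
    using slot_less[OF e] by (auto simp: offset_def)
  have "0 \<le> s * offset e v i" using s off by simp
  moreover have "s * offset e v i \<le> 1 * offset e v i" using s off by (intro mult_right_mono)
  ultimately show "real (m * base v i) \<le> x i \<and> x i \<le> real (m * base v i) + real m - 1"
    using x[OF i] off by simp
qed

lemma apex_block: "in_block v (apex v)"
  using m by (simp add: in_block_def apex_def)

text \<open>On the segment to the apex the columns interpolate between port and block corner; on the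
  adjacent unit of the track only coordinate \<open>D\<close> moves.\<close>

lemma curve_block:
  assumes e: "e \<in> E"
  shows "- 1 \<le> w \<Longrightarrow> w \<le> 1 \<Longrightarrow> in_block (src e) (curve e w)"
    and "T - 1 \<le> w \<Longrightarrow> w \<le> T + 1 \<Longrightarrow> in_block (tgt e) (curve e w)"
proof -
  show "in_block (src e) (curve e w)" if w: "- 1 \<le> w" "w \<le> 1"
  proof (cases "w \<le> 0")
    case True
    then show ?thesis using w by (intro in_blockI[OF e edge_ends(1)[OF e], of "1 + w"] curve_src(1)) auto
  next
    case False
    then show ?thesis using w T_ge
      by (intro in_blockI[OF e edge_ends(1)[OF e], of 1]) (auto simp: curve_track track_src port_real)
  qed
  show "in_block (tgt e) (curve e w)" if w: "T - 1 \<le> w" "w \<le> T + 1"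
  proof (cases "T \<le> w")
    case True
    then show ?thesis using w by (intro in_blockI[OF e edge_ends(2)[OF e], of "1 + (T - w)"] curve_tgt(1)) auto
  next
    case False
    then show ?thesis using w T_ge
      by (intro in_blockI[OF e edge_ends(2)[OF e], of 1]) (auto simp: curve_track track_tgt port_real)
  qed
qed

text \<open>Within one unit of the ends of its track, or beyond them, the edge lies in the block of
  another vertex. In between its level is at least \<open>1\<close>, while \<open>x\<close> is not
  above the face.\<close>

lemma curve_apart_block:
  assumes e: "e \<in> E" and v: "v \<in> V" "v \<notin> e" and w: "- 1 \<le> w" "w \<le> T + 1"
    and x: "in_block v x" "x D \<le> 0"
  shows "apart D (curve e w) x"
proof -
  have ne: "src e \<noteq> v" "tgt e \<noteq> v" using v(2) edge_ends[OF e] by auto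
  have inV: "src e \<in> V" "tgt e \<in> V" using edge[OF e] by auto
  consider "w \<le> 1" | "T - 1 \<le> w" | "1 \<le> w" "w \<le> T - 1" by linarith
  then show ?thesis
  proof cases
    case 1
    then show ?thesis using block_apart[OF inV(1) v(1) ne(1) curve_block(1)[OF e w(1)] x(1)] by simp
  next
    case 2
    then show ?thesis using block_apart[OF inV(2) v(1) ne(2) curve_block(2)[OF e _ w(2)] x(1)] by simp
  next
    case 3
    then have "1 \<le> curve e w D" using track_height_ge[OF e] by (simp add: curve_track)
    then show ?thesis using x(2) by (intro apartI[of _ D]) auto
  qed
qed

text \<open>Treats the two end segments alike: \<open>a\<close> is the depth beyond the face, with
  \<open>a = 1\<close> at the apex.\<close>

lemma curve_outside:
  assumes e: "e \<in> E" and w: "- 1 \<le> w" "w \<le> T + 1" "\<not> (0 \<le> w \<and> w \<le> T)"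
  shows "\<exists>v\<in>e. \<exists>a. 0 < a \<and> a \<le> 1 \<and> (v = src e \<and> w = - a \<or> v = tgt e \<and> w = T + a) \<and>
    (\<forall>i<D. curve e w i = real (m * base v i) + (1 - a) * offset e v i) \<and> curve e w D = - a \<and>
    in_block v (curve e w)"
proof (cases "w < 0")
  case True
  then show ?thesis
    using w edge_ends[OF e] curve_block(1)[OF e w(1)] T_ge
    by (intro bexI[of _ "src e"] exI[of _ "- w"]) (auto simp: curve_src)
next
  case False
  then show ?thesis
    using w edge_ends[OF e] curve_block(2)[OF e _ w(2)] T_ge
    by (intro bexI[of _ "tgt e"] exI[of _ "w - T"]) (auto simp: curve_tgt)
qed

text \<open>A point beyond the face lies in the block of a vertex off the other edge. If both points
  lie on tracks, either their times differ by at least \<open>1\<close> or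
  \<open>track_apart\<close> applies.\<close>

lemma curve_apart:
  assumes e: "e \<in> E" and f: "f \<in> E" and ef: "e \<inter> f = {}"
    and w: "- 1 \<le> w" "w \<le> T + 1" and w': "- 1 \<le> w'" "w' \<le> T + 1"
  shows "apart D (curve e w) (curve f w')"
proof -
  have outside: "apart D (curve e w) (curve f w')"
    if ef: "e \<in> E" "f \<in> E" "e \<inter> f = {}" and w: "- 1 \<le> w" "w \<le> T + 1"
      and w': "- 1 \<le> w'" "w' \<le> T + 1" "\<not> (0 \<le> w' \<and> w' \<le> T)"
    for e f w w'
  proof -
    obtain v a where "v \<in> f" "0 < a" "curve f w' D = - a" "in_block v (curve f w')"
      using curve_outside[OF ef(2) w'] by blast
    then show ?thesis using ef w edge_subset by (intro curve_apart_block) auto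
  qed
  consider "\<not> (0 \<le> w \<and> w \<le> T)" | "\<not> (0 \<le> w' \<and> w' \<le> T)" | "0 \<le> w" "w \<le> T" "0 \<le> w'" "w' \<le> T"
    by blast
  then show ?thesis
  proof cases
    case 1
    have "f \<inter> e = {}" using ef by blast
    then show ?thesis by (rule apart_sym[OF outside[OF f e _ w' w 1]])
  next
    case 2
    then show ?thesis by (rule outside[OF e f ef w w'])
  next
    case 3
    have "e \<noteq> f" using ef edge_ends(1)[OF e] by blast
    show ?thesis
    proof (cases "\<bar>w - w'\<bar> < 1")
      case True
      then obtain i where "i \<le> D" "1 \<le> \<bar>track e w i - track f w' i\<bar>"
        using track_apart[OF e f \<open>e \<noteq> f\<close>] 3 by blast
      then show ?thesis using 3 by (intro apartI[of _ i]) (auto simp: curve_track)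
    next
      case False
      then show ?thesis using 3 by (intro apartI[of _ "Suc D"]) (auto simp: curve_track)
    qed
  qed
qed

text \<open>Edges with a common vertex are covered too, so the apexes have to be excepted. The sign
  of coordinate \<open>D\<close> tells tracks from end segments; on tracks coordinate
  \<open>D + 1\<close> gives the time, on end segments the depth and the block give the
  position.\<close>

lemma curve_inj:
  assumes e: "e \<in> E" and f: "f \<in> E"
    and w: "- 1 \<le> w" "w \<le> T + 1" and w': "- 1 \<le> w'" "w' \<le> T + 1"
    and eq: "\<And>i. i \<le> Suc D \<Longrightarrow> curve e w i = curve f w' i"
  shows "e = f \<and> w = w' \<or> w \<in> {- 1, T + 1}"
proof (cases "0 \<le> w \<and> w \<le> T")
  case True
  have "0 \<le> curve e w D" using True track_bounds(1)[OF e] by (simp add: curve_track)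
  then have "\<not> curve f w' D < 0" using eq[of D] by simp
  then have w'2: "0 \<le> w'" "w' \<le> T"
    using curve_outside[OF f w'] by fastforce+
  have "w = w'" using eq[of "Suc D"] True w'2 by (simp add: curve_track)
  moreover have "e = f"
  proof (rule ccontr)
    assume "e \<noteq> f"
    moreover have "\<bar>w - w'\<bar> < 1" using \<open>w = w'\<close> by simp
    ultimately obtain i where "i \<le> D" "1 \<le> \<bar>track e w i - track f w' i\<bar>"
      using track_apart[OF e f] True w'2 by blast
    then show False using eq[of i] True w'2 by (simp add: curve_track)
  qed
  ultimately show ?thesis by simp
next
  case False
  obtain v a where v: "v \<in> e" "0 < a" "a \<le> 1" "v = src e \<and> w = - a \<or> v = tgt e \<and> w = T + a"
    "\<forall>i<D. curve e w i = real (m * base v i) + (1 - a) * offset e v i" "curve e w D = - a"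
    "in_block v (curve e w)"
    using curve_outside[OF e w False] by blast
  have "\<not> (0 \<le> w' \<and> w' \<le> T)"
    using eq[of D] v(2,6) track_bounds(1)[OF f order_refl, of w'] by (auto simp: curve_track)
  then obtain v' a' where v': "v' \<in> f" "v' = src f \<and> w' = - a' \<or> v' = tgt f \<and> w' = T + a'"
    "\<forall>i<D. curve f w' i = real (m * base v' i) + (1 - a') * offset f v' i" "curve f w' D = - a'"
    "in_block v' (curve f w')"
    using curve_outside[OF f w'] by blast
  have "a' = a" using eq[of D] v(6) v'(4) by simp
  have "v' = v"
  proof (rule ccontr)
    assume "v' \<noteq> v"
    then have "apart D (curve e w) (curve f w')"
      using block_apart v(1,7) v'(1,5) e f edge_subset by metis
    then show False using apart_neq eq by blast
  qed
  show ?thesis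
  proof (cases "e = f")
    case True
    then show ?thesis using v(4) v'(2) \<open>a' = a\<close> \<open>v' = v\<close> edge[OF e] by auto
  next
    case False
    \<comment> \<open>In coordinate \<open>0\<close> the two segments differ by \<open>1 - a\<close>
      times a nonzero difference of slots, so they meet only at the apex.\<close>
    have "(1 - a) * real (slot e v) = (1 - a) * real (slot f v)"
      using eq[of 0] D v(5) v'(3) \<open>a' = a\<close> \<open>v' = v\<close> by (simp add: offset_def)
    moreover have "slot e v \<noteq> slot f v" using slot_neq[OF e f v(1)] v'(1) \<open>v' = v\<close> False by simp
    ultimately have "a = 1" by simp
    then show ?thesis using v(4) by auto
  qed
qed

lemma curve_eq_apex:
  assumes e: "e \<in> E" and w: "- 1 \<le> w" "w \<le> T + 1" and eq: "curve e w D = - 1"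
  shows "w \<in> {- 1, T + 1}"
proof -
  have "\<not> (0 \<le> w \<and> w \<le> T)"
    using eq track_bounds(1)[OF e order_refl, of w] by (auto simp: curve_track)
  then obtain v a where "v = src e \<and> w = - a \<or> v = tgt e \<and> w = T + a" "curve e w D = - a"
    using curve_outside[OF e w] by blast
  then show ?thesis using eq by auto
qed

lemma apex_apart: "v \<in> V \<Longrightarrow> w \<in> V \<Longrightarrow> v \<noteq> w \<Longrightarrow> apart D (apex v) (apex w)"
  using block_apart apex_block by blast

lemma curve_bounds:
  assumes e: "e \<in> E" and w: "- 1 \<le> w" "w \<le> T + 1"
  shows "i \<le> D \<Longrightarrow> \<bar>curve e w i\<bar> \<le> 2 * real B" and "0 \<le> curve e w (Suc D)" "curve e w (Suc D) \<le> T"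
proof -
  show "\<bar>curve e w i\<bar> \<le> 2 * real B" if i: "i \<le> D"
  proof (cases "0 \<le> w \<and> w \<le> T")
    case True
    then show ?thesis using track_bounds[OF e i] i by (simp add: curve_track)
  next
    case False
    then obtain v a where v: "v \<in> e" "0 < a" "a \<le> 1" "curve e w D = - a" "in_block v (curve e w)"
      using curve_outside[OF e w] by blast
    have B: "m * base v j + m \<le> B" if "j < D" for j using base_bound[OF edge_subset[OF e v(1)] that] .
    show ?thesis
    proof (cases "i = D")
      case True
      have "1 \<le> B" using B[OF D] m by simp
      then show ?thesis using True v by simp
    next
      case False
      then have "i < D" using i by simp
      then have "real (m * base v i) \<le> curve e w i \<and> curve e w i \<le> real (m * base v i) + real m - 1"
        using v(5) by (simp add: in_block_def)
      moreover have "real (m * base v i) + real m \<le> real B" using B[OF \<open>i < D\<close>] by (metis of_nat_add of_nat_mono)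
      ultimately show ?thesis by (smt (verit) of_nat_0_le_iff)
    qed
  qed
  have "0 \<le> curve e w (Suc D) \<and> curve e w (Suc D) \<le> T"
  proof (cases "T \<le> w")
    case True
    have "T * (1 + (T - w)) \<le> T * 1" using True T_ge by (intro mult_left_mono) auto
    moreover have "0 \<le> T * (1 + (T - w))" using w T_ge by simp
    ultimately show ?thesis using curve_tgt(3)[OF True] by simp
  next
    case False
    then show ?thesis using T_ge by (auto simp: curve_def)
  qed
  then show "0 \<le> curve e w (Suc D)" "curve e w (Suc D) \<le> T" by auto
qed

lemma continuous_on_curve: "continuous_on S (\<lambda>w. curve e w i)"
  unfolding curve_def track_def
  by (cases "i < D"; cases "i = D") (auto intro!: continuous_intros)

end

section \<open>The embedding\<close>

lemma edge_point_ends: "edge_point u v 0 = vertex_point u" "edge_point u v 1 = vertex_point v"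
  by (auto simp: edge_point_def)

lemma edge_point_flip: "edge_point v u t = edge_point u v (1 - t)"
  by (auto simp: edge_point_def)

lemma edge_cell_eq: "edge_cell {u, v} = edge_point u v ` {0..1}"
proof
  show "edge_cell {u, v} \<subseteq> edge_point u v ` {0..1}"
  proof
    fix x assume "x \<in> edge_cell {u, v}"
    then obtain u' v' t where x: "x = edge_point u' v' t" "{u, v} = {u', v'}" "t \<in> {0..1}"
      by (auto simp: edge_cell_def)
    from x(2) have "u' = u \<and> v' = v \<or> u' = v \<and> v' = u" by (auto simp: doubleton_eq_iff)
    then show "x \<in> edge_point u v ` {0..1}"
    proof
      assume "u' = v \<and> v' = u"
      then have "x = edge_point u v (1 - t)" using x(1) edge_point_flip by metis
      then show ?thesis using x(3) by (intro image_eqI[of _ _ "1 - t"]) auto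
    qed (use x in auto)
  qed
next
  show "edge_point u v ` {0..1} \<subseteq> edge_cell {u, v}" unfolding edge_cell_def by blast
qed

lemma topspace_realisation: "topspace (realisation V E) = realisation_points V E"
proof
  show "topspace (realisation V E) \<subseteq> realisation_points V E"
    using openin_topspace[of "realisation V E"] unfolding openin_realisation by blast
  have "{t \<in> {0..1}. edge_point u v t \<in> realisation_points V E} = {0..1}" if "{u, v} \<in> E" for u v
    using that edge_cell_eq[of u v] unfolding realisation_points_def by blast
  then show "realisation_points V E \<subseteq> topspace (realisation V E)"
    by (intro openin_subset) (simp add: openin_realisation)
qed

lemma continuous_map_edge_point:
  assumes "{u, v} \<in> E"
  shows "continuous_map (top_of_set {0..1}) (realisation V E) (edge_point u v)"
  unfolding continuous_map_def topspace_realisation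
proof (intro conjI allI impI)
  show "edge_point u v \<in> topspace (top_of_set {0..1}) \<rightarrow> realisation_points V E"
    using assms edge_cell_eq[of u v] by (fastforce simp: realisation_points_def)
qed (use assms in \<open>auto simp: openin_realisation\<close>)

text \<open>Finitely many vertices and finitely many continuous images of \<open>{0..1}\<close>
  cover the realisation. Compactness later turns a continuous injection into a Hausdorff space into
  an embedding.\<close>

lemma compact_space_realisation:
  assumes V: "finite V" and E: "simple_graph V E"
  shows "compact_space (realisation V E)"
proof -
  have "E \<subseteq> Pow V" using E by (auto simp: simple_graph_def)
  then have fE: "finite E" using V by (meson finite_Pow_iff finite_subset)
  have "compactin (realisation V E) (edge_cell e)" if e: "e \<in> E" for e
  proof -
    obtain u v where uv: "e = {u, v}" using E e by (auto simp: simple_graph_def card_2_iff)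
    have "compactin (top_of_set {0..1::real}) {0..1}" by (simp add: compactin_subtopology)
    then show ?thesis
      unfolding uv edge_cell_eq
      using image_compactin continuous_map_edge_point[of u v E V] e uv by blast
  qed
  moreover have "compactin (realisation V E) (vertex_point ` V)"
    using V by (intro finite_imp_compactin) (auto simp: topspace_realisation realisation_points_def)
  ultimately have "compactin (realisation V E) (realisation_points V E)"
    unfolding realisation_points_def using fE
    by (intro compactin_Un compactin_Union) auto
  then show ?thesis by (simp add: compact_space_def topspace_realisation)
qed

text \<open>The universal property of the quotient topology.\<close>

lemma continuous_map_realisation:
  assumes f: "\<And>\<xi>. \<xi> \<in> realisation_points V E \<Longrightarrow> f \<xi> \<in> topspace Z"
    and cont: "\<And>u v. {u, v} \<in> E \<Longrightarrow> continuous_map (top_of_set {0..1}) Z (\<lambda>t. f (edge_point u v t))"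
  shows "continuous_map (realisation V E) Z f"
  unfolding continuous_map_def topspace_realisation
proof (intro conjI allI impI)
  show "openin (realisation V E) {\<xi> \<in> realisation_points V E. f \<xi> \<in> U}" if U: "openin Z U" for U
    unfolding openin_realisation
  proof (intro conjI allI impI)
    fix u v assume uv: "{u, v} \<in> E"
    have "{t \<in> {0..1}. edge_point u v t \<in> {\<xi> \<in> realisation_points V E. f \<xi> \<in> U}} =
        {t \<in> {0..1}. f (edge_point u v t) \<in> U}"
      using uv edge_cell_eq[of u v] unfolding realisation_points_def by blast
    then show "openin (top_of_set {0..1}) {t \<in> {0..1}. edge_point u v t \<in> {\<xi> \<in> realisation_points V E. f \<xi> \<in> U}}"
      using cont[OF uv] U by (simp add: continuous_map_def)
  qed auto
qed (use f in auto)

lemma vertex_point_support: "{w. vertex_point v w \<noteq> 0} = {v}"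
  by (auto simp: vertex_point_def)

lemma edge_point_support: "u \<noteq> v \<Longrightarrow> 0 < t \<Longrightarrow> t < 1 \<Longrightarrow> {w. edge_point u v t w \<noteq> 0} = {u, v}"
  by (auto simp: edge_point_def vertex_point_def)

lemma edge_point_coord: "u \<noteq> v \<Longrightarrow> edge_point u v t v = t"
  by (auto simp: edge_point_def vertex_point_def)

text \<open>Euclidean and horizontal hyperbolic coordinates are scaled alike. The factor
  \<open>2\<close> in the exponent makes a unit step raise a height \<open>h\<close> by at least
  \<open>exp 1 * h\<close>, as \<open>RH_dist_ge_one\<close> demands.\<close>

definition chart :: "nat \<Rightarrow> real \<Rightarrow> (nat \<Rightarrow> real) \<Rightarrow> nat \<Rightarrow> real" where
  "chart D K x i = (if i \<le> D then K * x i else if i = Suc D then exp (2 * x i) else undefined)"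

lemma chart_height: "r + q = D + 2 \<Longrightarrow> chart D K x (r + q - 1) = exp (2 * x (Suc D))"
  by (simp add: chart_def)

lemma chart_carrier: "r + q = D + 2 \<Longrightarrow> chart D K x \<in> RH_carrier r q"
  using chart_height[of r q D K x] by (auto simp: RH_carrier_def PiE_def extensional_def chart_def)

lemma chart_apart:
  assumes n: "r + q = D + 2" and K: "exp (2 * T + 1) \<le> K" and xy: "apart D x y"
    and x: "0 \<le> x (Suc D)" "x (Suc D) \<le> T" and y: "0 \<le> y (Suc D)" "y (Suc D) \<le> T"
  shows "1 \<le> RH_dist r q (chart D K x) (chart D K y)"
proof -
  interpret Metric_space "RH_carrier r q" "RH_dist r q" by (rule Metric_space_RH)
  \<comment> \<open>The lower point comes first, since \<open>RH_dist_ge_one\<close> compares with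
    the height of its first argument.\<close>
  have up: "1 \<le> RH_dist r q (chart D K x) (chart D K y)"
    if x: "0 \<le> x (Suc D)" and xy: "x (Suc D) + 1 \<le> y (Suc D)" for x y
  proof (rule RH_dist_ge_one[OF chart_carrier[OF n] chart_carrier[OF n]])
    show "r + q - 1 < r + q" using n by simp
    let ?a = "exp (2 * x (Suc D))"
    have e: "2 \<le> exp (1::real)" using exp_ge_add_one_self[of 1] by simp
    have "exp 2 = exp 1 * exp (1::real)" by (simp add: exp_add[symmetric])
    moreover have "2 * exp 1 \<le> exp 1 * exp (1::real)" using e by (intro mult_right_mono) auto
    ultimately have e2: "exp 1 + 1 \<le> exp (2::real)" using e by linarith
    have a: "1 \<le> ?a" using x by simp
    have "(exp 1 + 1) * ?a \<le> exp 2 * ?a" using e2 by (intro mult_right_mono) auto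
    also have "\<dots> = exp (2 * (x (Suc D) + 1))" by (simp add: exp_add[symmetric] algebra_simps)
    also have "\<dots> \<le> exp (2 * y (Suc D))" using xy by simp
    finally have "exp 1 * ?a \<le> exp (2 * y (Suc D)) - ?a" by (simp add: algebra_simps)
    moreover have "1 * 1 \<le> exp 1 * ?a" using e a by (intro mult_mono) auto
    ultimately show "max 1 (exp 1 * chart D K x (r + q - 1))
        \<le> \<bar>chart D K y (r + q - 1) - chart D K x (r + q - 1)\<bar>"
      unfolding chart_height[OF n] by simp
  qed
  obtain i where i: "i \<le> Suc D" "1 \<le> \<bar>x i - y i\<bar>" using xy by (auto simp: apart_def)
  show ?thesis
  proof (cases "i = Suc D")
    case True
    then have "1 \<le> \<bar>x (Suc D) - y (Suc D)\<bar>" using i(2) by simp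
    then have "x (Suc D) + 1 \<le> y (Suc D) \<or> y (Suc D) + 1 \<le> x (Suc D)" by linarith
    then show ?thesis using up[of x y] up[of y x] x y by (auto simp: commute)
  next
    case False
    then have iD: "i \<le> D" using i by simp
    show ?thesis
    proof (rule RH_dist_ge_one[OF chart_carrier[OF n] chart_carrier[OF n]])
      show "i < r + q" using iD n by simp
      have K0: "0 \<le> K" using K exp_ge_zero order_trans by blast
      \<comment> \<open>The scale \<open>K\<close> dominates \<open>exp 1\<close> times every height
        up to \<open>exp (2 * T)\<close>, so a unit gap in a horizontal coordinate suffices.\<close>
      have "exp 1 * exp (2 * x (Suc D)) \<le> K"
        using x(2) by (intro order_trans[OF _ K]) (simp add: exp_add[symmetric])
      moreover have "1 \<le> exp (1 + 2 * x (Suc D))" using x(1) by simp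
      ultimately have "max 1 (exp 1 * chart D K x (r + q - 1)) \<le> K * 1"
        unfolding chart_height[OF n] by (simp add: exp_add)
      also have "\<dots> \<le> K * \<bar>y i - x i\<bar>" using i(2) K0 by (intro mult_left_mono) auto
      also have "\<dots> = \<bar>chart D K y i - chart D K x i\<bar>"
        using iD K0 by (simp add: chart_def right_diff_distrib[symmetric] abs_mult)
      finally show "max 1 (exp 1 * chart D K x (r + q - 1)) \<le> \<bar>chart D K y i - chart D K x i\<bar>" .
    qed
  qed
qed

lemma set_dist_ge:
  assumes "A \<noteq> {}" "B \<noteq> {}" "\<And>a b. a \<in> A \<Longrightarrow> b \<in> B \<Longrightarrow> k \<le> \<delta> a b"
  shows "k \<le> set_dist \<delta> A B"
  unfolding set_dist_def using assms by (intro cINF_greatest) auto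

text \<open>The factors bound the density, the \<open>D + 1\<close> horizontal sides and the height
  of the box around the neighbourhood; \<open>16 * D\<close> is \<open>2 * T + 2\<close>.\<close>

definition volume_const :: "nat \<Rightarrow> real" where
  "volume_const D = exp 2 ^ (D + 2) *
     ((2 * (4 * exp (16 * real D))) ^ Suc D * (3 * exp (16 * real D)))"

section \<open>The embedding of a routed graph\<close>

context routed_graph
begin

text \<open>The support of the barycentric coordinates recovers the open cell of a point, and the
  coordinate at the target is the parameter, rescaled from \<open>[0, 1]\<close> to
  \<open>[- 1, T + 1]\<close>.\<close>

definition place :: "('v \<Rightarrow> real) \<Rightarrow> nat \<Rightarrow> real" where
  "place \<xi> = (let e = {v. \<xi> v \<noteq> 0} in
     if e \<in> E then curve e ((T + 2) * \<xi> (tgt e) - 1) else apex (THE v. \<xi> v \<noteq> 0))"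

definition embed :: "('v \<Rightarrow> real) \<Rightarrow> nat \<Rightarrow> real" where
  "embed \<xi> = chart D (exp (2 * T + 1)) (place \<xi>)"

lemma simple: "simple_graph V E"
  unfolding simple_graph_def
proof
  fix e assume e: "e \<in> E"
  have "card e = card {src e, tgt e}" using edge[OF e] by (intro arg_cong[where f = card]) blast
  also have "\<dots> = 2" using edge[OF e] by (intro card_2_iff[THEN iffD2]) blast
  finally show "e \<subseteq> V \<and> card e = 2" using edge_subset[OF e] by blast
qed

lemma place_vertex: "place (vertex_point v) = apex v"
proof -
  have "{v} \<notin> E"
  proof
    assume "{v} \<in> E"
    then show False using edge[of "{v}"] by (metis insertI1 insert_commute singletonD)
  qed
  moreover have "(THE w. vertex_point v w \<noteq> 0) = v"
    by (rule the_equality) (auto simp: vertex_point_def split: if_splits)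
  ultimately show ?thesis by (simp add: place_def vertex_point_support)
qed

text \<open>At \<open>t = 0\<close> and \<open>t = 1\<close> the support is a single vertex, so the
  other branch of \<open>place\<close> applies; \<open>curve_ends\<close> shows that it gives the
  same value.\<close>

lemma place_edge:
  assumes e: "e \<in> E" and t: "0 \<le> t" "t \<le> 1"
  shows "place (edge_point (src e) (tgt e) t) = curve e ((T + 2) * t - 1)"
proof -
  consider "t = 0" | "t = 1" | "0 < t" "t < 1" using t by linarith
  then show ?thesis
  proof cases
    case 1
    then show ?thesis by (simp add: edge_point_ends place_vertex curve_ends)
  next
    case 2
    moreover have "(T + 2) * 1 - 1 = T + 1" by simp
    ultimately show ?thesis by (simp only: edge_point_ends place_vertex curve_ends)
  next
    case 3
    have ne: "src e \<noteq> tgt e" and eq: "{src e, tgt e} = e" using edge[OF e] by auto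
    show ?thesis
      using e edge_point_support[OF ne 3] by (simp add: place_def eq edge_point_coord[OF ne])
  qed
qed

lemma parameter_range:
  assumes "0 \<le> t" "t \<le> 1"
  shows "- 1 \<le> (T + 2) * t - 1 \<and> (T + 2) * t - 1 \<le> T + 1"
proof -
  have "0 \<le> (T + 2) * t" using assms T_ge by simp
  moreover have "(T + 2) * t \<le> (T + 2) * 1" using assms T_ge by (intro mult_left_mono) auto
  ultimately show ?thesis by simp
qed

lemma edge_cell_points:
  assumes "e \<in> E" "\<xi> \<in> edge_cell e"
  obtains w where "- 1 \<le> w" "w \<le> T + 1" "place \<xi> = curve e w"
proof -
  have "e = {src e, tgt e}" using edge[OF assms(1)] by blast
  then have "\<xi> \<in> edge_point (src e) (tgt e) ` {0..1}" using assms(2) edge_cell_eq by metis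
  then obtain t where "\<xi> = edge_point (src e) (tgt e) t" "0 \<le> t" "t \<le> 1" by auto
  then show ?thesis
    using that[of "(T + 2) * t - 1"] parameter_range[of t] place_edge[OF assms(1), of t] by simp
qed

lemma points_cases:
  assumes "\<xi> \<in> realisation_points V E"
  obtains (at_vertex) v where "v \<in> V" "\<xi> = vertex_point v"
    | (on_edge) e t where "e \<in> E" "0 < t" "t < 1" "\<xi> = edge_point (src e) (tgt e) t"
proof (cases "\<xi> \<in> vertex_point ` V")
  case False
  then obtain e where e: "e \<in> E" "\<xi> \<in> edge_cell e" using assms by (auto simp: realisation_points_def)
  have ends: "e = {src e, tgt e}" "src e \<in> V" "tgt e \<in> V" using edge[OF e(1)] by auto
  then have "\<xi> \<in> edge_point (src e) (tgt e) ` {0..1}" using e(2) edge_cell_eq by metis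
  then obtain t where t: "\<xi> = edge_point (src e) (tgt e) t" "0 \<le> t" "t \<le> 1" by auto
  then have "t \<noteq> 0" "t \<noteq> 1" using False ends by (auto simp: edge_point_ends)
  then show ?thesis using that(2)[of e t] e t by simp
qed auto

text \<open>A point of the realisation presupposes a vertex, whose block has to fit into the face;
  hence \<open>1 \<le> B\<close>.\<close>

lemma place_bounds:
  assumes "\<xi> \<in> realisation_points V E"
  shows "i \<le> D \<Longrightarrow> \<bar>place \<xi> i\<bar> \<le> 2 * real B" "0 \<le> place \<xi> (Suc D)" "place \<xi> (Suc D) \<le> T" "1 \<le> B"
proof -
  have "(\<forall>i\<le>D. \<bar>place \<xi> i\<bar> \<le> 2 * real B) \<and> 0 \<le> place \<xi> (Suc D) \<and> place \<xi> (Suc D) \<le> T \<and> 1 \<le> B"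
    using assms
  proof (cases rule: points_cases)
    case (at_vertex v)
    have B: "m * base v i + m \<le> B" if "i < D" for i using base_bound[OF at_vertex(1) that] .
    then have "real (m * base v i) \<le> real B" if "i < D" for i
      using that by (intro of_nat_mono) (meson add_leD1)
    moreover have "1 \<le> B" using B[OF D] m by simp
    ultimately show ?thesis using T_ge at_vertex by (force simp: place_vertex apex_def)
  next
    case (on_edge e t)
    have e: "m * base (src e) 0 + m \<le> B"
      using base_bound[OF _ D] edge_subset[OF on_edge(1) edge_ends(1)[OF on_edge(1)]] by blast
    have "place \<xi> = curve e ((T + 2) * t - 1)" using on_edge place_edge by simp
    then show ?thesis
      using curve_bounds[OF on_edge(1), of "(T + 2) * t - 1"] parameter_range[of t] on_edge e m by simp
  qed
  then show "i \<le> D \<Longrightarrow> \<bar>place \<xi> i\<bar> \<le> 2 * real B" "0 \<le> place \<xi> (Suc D)" "place \<xi> (Suc D) \<le> T" "1 \<le> B"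
    by auto
qed

lemma place_inj:
  assumes x: "\<xi> \<in> realisation_points V E" and y: "\<eta> \<in> realisation_points V E"
    and eq: "\<And>i. i \<le> Suc D \<Longrightarrow> place \<xi> i = place \<eta> i"
  shows "\<xi> = \<eta>"
proof -
  have interior: "(T + 2) * t - 1 \<notin> {- 1, T + 1}" if "0 < t" "t < 1" for t
  proof -
    have "0 < (T + 2) * t" using that T_ge by simp
    moreover have "(T + 2) * t < (T + 2) * 1" using that T_ge by (intro mult_strict_left_mono) auto
    ultimately show ?thesis using that by auto
  qed
  \<comment> \<open>Coordinate \<open>D\<close> equals \<open>- 1\<close> at the apexes and nowhere
    in the interior of an edge.\<close>
  have mixed: "place (vertex_point v) D \<noteq> place (edge_point (src e) (tgt e) t) D"
    if "e \<in> E" "0 < t" "t < 1" for v e t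
    using curve_eq_apex[OF that(1), of "(T + 2) * t - 1"] parameter_range[of t] interior[OF that(2,3)] that
    by (auto simp: place_vertex place_edge apex_def)
  show ?thesis
    using x
  proof (cases rule: points_cases)
    case x: (at_vertex v)
    show ?thesis
      using y
    proof (cases rule: points_cases)
      case y: (at_vertex w)
      then show ?thesis
        using apart_neq[OF apex_apart[OF x(1) y(1)]] eq x by (auto simp: place_vertex)
    next
      case y: (on_edge e t)
      then show ?thesis using mixed[of e t v] eq[of D] x by simp
    qed
  next
    case x: (on_edge e t)
    show ?thesis
      using y
    proof (cases rule: points_cases)
      case y: (at_vertex w)
      then show ?thesis using mixed[of e t w] eq[of D] x by simp
    next
      case y: (on_edge f s)
      have "curve e ((T + 2) * t - 1) i = curve f ((T + 2) * s - 1) i" if "i \<le> Suc D" for i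
        using eq[OF that] x y by (simp add: place_edge)
      then have "e = f \<and> (T + 2) * t - 1 = (T + 2) * s - 1"
        using curve_inj[OF x(1) y(1), of "(T + 2) * t - 1" "(T + 2) * s - 1"]
          parameter_range[of t] parameter_range[of s] interior x y by auto
      then show ?thesis using x y T_ge by simp
    qed
  qed
qed

lemma continuous_embed:
  assumes n: "r + q = D + 2"
  shows "continuous_map (realisation V E) (mtopology_of (RH_metric r q)) embed"
proof (rule continuous_map_realisation)
  show "embed \<xi> \<in> topspace (mtopology_of (RH_metric r q))" for \<xi>
    by (simp add: embed_def mspace_RH_metric chart_carrier[OF n])
next
  fix u v assume uv: "{u, v} \<in> E"
  define e where "e = {u, v}"
  have e: "e \<in> E" using uv by (simp add: e_def)
  have sub: "edge_point u v t \<in> realisation_points V E" if "t \<in> {0..1}" for t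
    using uv that edge_cell_eq[of u v] by (auto simp: realisation_points_def)
  \<comment> \<open>The realisation parametrises an edge in both directions; against the chosen
    orientation the parameter is reversed.\<close>
  have "u = src e \<and> v = tgt e \<or> u = tgt e \<and> v = src e"
    using edge[OF e] by (simp add: e_def doubleton_eq_iff)
  then have "\<exists>k. continuous_on {0..1} k \<and> (\<forall>t\<in>{0..1}. place (edge_point u v t) = curve e (k t))"
  proof
    assume "u = src e \<and> v = tgt e"
    then show ?thesis
      by (intro exI[of _ "\<lambda>t. (T + 2) * t - 1"]) (auto intro!: continuous_intros simp: place_edge[OF e])
  next
    assume a: "u = tgt e \<and> v = src e"
    have "place (edge_point u v t) = curve e ((T + 2) * (1 - t) - 1)" if "t \<in> {0..1}" for t
      using place_edge[OF e, of "1 - t"] that a edge_point_flip[of u v t] by simp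
    then show ?thesis
      by (intro exI[of _ "\<lambda>t. (T + 2) * (1 - t) - 1"]) (auto intro!: continuous_intros)
  qed
  then obtain k where k: "continuous_on {0..1} k" "\<And>t. t \<in> {0..1} \<Longrightarrow> place (edge_point u v t) = curve e (k t)"
    by blast
  have cont: "continuous_on {0..1} (\<lambda>t. place (edge_point u v t) i)" for i
  proof -
    have "continuous_on {0..1} (\<lambda>t. curve e (k t) i)"
      by (rule continuous_on_compose2[OF continuous_on_curve[of UNIV e i] k(1)]) simp
    then show ?thesis by (rule continuous_on_eq) (simp add: k(2))
  qed
  show "continuous_map (top_of_set {0..1}) (mtopology_of (RH_metric r q)) (\<lambda>t. embed (edge_point u v t))"
  proof (rule continuous_map_RH)
    show "embed (edge_point u v t) \<in> RH_carrier r q" for t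
      by (simp add: embed_def chart_carrier[OF n])
    show "0 < r + q" using n by simp
    show "1 \<le> embed (edge_point u v t) (r + q - 1)" if "t \<in> {0..1}" for t
      using place_bounds(2)[OF sub[OF that]] unfolding embed_def chart_height[OF n] by simp
    show "continuous_on {0..1} (\<lambda>t. embed (edge_point u v t) i)" if "i < r + q" for i
      unfolding embed_def chart_def using cont
      by (cases "i \<le> D"; cases "i = Suc D") (auto intro!: continuous_intros)
  qed
qed

lemma inj_embed: "inj_on embed (realisation_points V E)"
proof (rule inj_onI)
  fix \<xi> \<eta> assume pts: "\<xi> \<in> realisation_points V E" "\<eta> \<in> realisation_points V E"
    and eq: "embed \<xi> = embed \<eta>"
  have "place \<xi> i = place \<eta> i" if "i \<le> Suc D" for i
    using fun_cong[OF eq, of i] that by (auto simp: embed_def chart_def le_Suc_eq)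
  then show "\<xi> = \<eta>" by (rule place_inj[OF pts])
qed

lemma embed_apart:
  assumes n: "r + q = D + 2" and "\<xi> \<in> realisation_points V E" "\<eta> \<in> realisation_points V E"
    and "apart D (place \<xi>) (place \<eta>)"
  shows "1 \<le> mdist (RH_metric r q) (embed \<xi>) (embed \<eta>)"
  unfolding mdist_RH_metric embed_def
  using assms by (intro chart_apart[OF n order_refl]) (auto intro: place_bounds)

lemma thick_embed:
  assumes n: "r + q = D + 2"
  shows "thick_embedding (RH_metric r q) 1 V E embed"
  unfolding thick_embedding_def
proof (intro conjI ballI impI)
  interpret Metric_space "RH_carrier r q" "RH_dist r q" by (rule Metric_space_RH)
  have "Hausdorff_space (mtopology_of (RH_metric r q))"
    by (simp add: mtopology_of_def mspace_RH_metric mdist_RH_metric Hausdorff_space_mtopology)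
  then show "embedding_map (realisation V E) (mtopology_of (RH_metric r q)) embed"
    using continuous_embed[OF n] compact_space_realisation[OF finite_V simple] inj_embed
    by (intro injective_closed_imp_embedding_map continuous_imp_closed_map_gen)
      (auto simp: topspace_realisation Hausdorff_imp_kc_space)
next
  fix u v assume uv: "u \<in> V" "v \<in> V" "u \<noteq> v"
  then show "1 \<le> mdist (RH_metric r q) (embed (vertex_point u)) (embed (vertex_point v))"
    by (intro embed_apart[OF n]) (auto simp: realisation_points_def place_vertex apex_apart)
next
  fix e v assume e: "e \<in> E" and v: "v \<in> V" "v \<notin> e"
  have "1 \<le> mdist (RH_metric r q) (embed \<xi>) (embed (vertex_point v))" if xi: "\<xi> \<in> edge_cell e" for \<xi>
  proof (rule embed_apart[OF n])
    obtain w where w: "- 1 \<le> w" "w \<le> T + 1" "place \<xi> = curve e w" by (rule edge_cell_points[OF e xi])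
    have "apart D (curve e w) (apex v)"
      by (rule curve_apart_block[OF e v w(1,2) apex_block]) (simp add: apex_def)
    then show "apart D (place \<xi>) (place (vertex_point v))" using w(3) by (simp add: place_vertex)
  qed (use e v xi in \<open>auto simp: realisation_points_def\<close>)
  moreover have "edge_cell e \<noteq> {}" using edge[OF e] edge_cell_eq[of "src e" "tgt e"] by auto
  ultimately show "1 \<le> set_dist (mdist (RH_metric r q)) (embed ` edge_cell e) {embed (vertex_point v)}"
    by (intro set_dist_ge) auto
next
  fix e f assume e: "e \<in> E" and f: "f \<in> E" and ef: "e \<inter> f = {}"
  have "1 \<le> mdist (RH_metric r q) (embed \<xi>) (embed \<eta>)" if xi: "\<xi> \<in> edge_cell e" and eta: "\<eta> \<in> edge_cell f" for \<xi> \<eta>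
  proof (rule embed_apart[OF n])
    obtain w where w: "- 1 \<le> w" "w \<le> T + 1" "place \<xi> = curve e w" by (rule edge_cell_points[OF e xi])
    obtain w' where w': "- 1 \<le> w'" "w' \<le> T + 1" "place \<eta> = curve f w'" by (rule edge_cell_points[OF f eta])
    show "apart D (place \<xi>) (place \<eta>)"
      unfolding w(3) w'(3) by (rule curve_apart[OF e f ef w(1,2) w'(1,2)])
  qed (use e f xi eta in \<open>auto simp: realisation_points_def\<close>)
  moreover have "edge_cell e \<noteq> {}" if "e \<in> E" for e
    using edge[OF that] edge_cell_eq[of "src e" "tgt e"] by auto
  ultimately show "1 \<le> set_dist (mdist (RH_metric r q)) (embed ` edge_cell e) (embed ` edge_cell f)"
    using e f by (intro set_dist_ge) auto
qed

text \<open>Heights are bounded in terms of \<open>D\<close>, so a unit neighbourhood widens each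
  coordinate by a bounded amount only. It fits into a box with \<open>D + 1\<close> sides
  proportional to \<open>B\<close>.\<close>

lemma embed_volume:
  assumes n: "r + q = D + 2" and q: "0 < q"
  shows "embedding_volume (RH_metric r q) (RH_volume r q) V E embed \<le> ennreal (volume_const D * real B ^ Suc D)"
proof -
  interpret Metric_space "RH_carrier r q" "RH_dist r q" by (rule Metric_space_RH)
  let ?X = "exp (16 * real D)"
  define M where "M = (4 * ?X) * real B"
  have X: "exp (2 * T + 1) \<le> ?X" "exp 2 * exp (2 * T) = ?X" "exp (2 * T) \<le> ?X"
    by (auto simp: T_def exp_add[symmetric])
  have box: "z \<in> RH_carrier r q \<and> (\<forall>i<r + q - 1. \<bar>z i\<bar> \<le> M) \<and>
      exp (- 2) \<le> z (r + q - 1) \<and> z (r + q - 1) \<le> 3 * ?X"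
    if z: "z \<in> nbhd (RH_metric r q) 1 (embed ` realisation_points V E)" for z
  proof -
    obtain \<xi> where zC: "z \<in> RH_carrier r q" and \<xi>: "\<xi> \<in> realisation_points V E"
      and d: "RH_dist r q (embed \<xi>) z \<le> 1"
      using z by (auto simp: nbhd_def mspace_RH_metric mdist_RH_metric commute)
    note b = place_bounds[OF \<xi>]
    have eC: "embed \<xi> \<in> RH_carrier r q" by (simp add: embed_def chart_carrier[OF n])
    have h: "embed \<xi> (r + q - 1) = exp (2 * place \<xi> (Suc D))" unfolding embed_def by (rule chart_height[OF n])
    have h1: "1 \<le> embed \<xi> (r + q - 1)" unfolding h using b(2) by simp
    have hT: "embed \<xi> (r + q - 1) \<le> exp (2 * T)" unfolding h using b(3) by simp
    note near = RH_dist_le_oneD[OF eC zC q d h1]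
    have "exp 2 * embed \<xi> (r + q - 1) \<le> exp 2 * exp (2 * T)" using hT by (intro mult_left_mono) auto
    then have dz: "\<bar>z i - embed \<xi> i\<bar> \<le> 2 * ?X" if "i < r + q" for i
      using near(2)[OF that] X(2) by linarith
    have "\<bar>z i\<bar> \<le> M" if i: "i < r + q - 1" for i
    proof -
      have iD: "i \<le> D" using i n by simp
      have "\<bar>embed \<xi> i\<bar> = exp (2 * T + 1) * \<bar>place \<xi> i\<bar>" using iD by (simp add: embed_def chart_def abs_mult)
      also have "\<dots> \<le> ?X * (2 * real B)" using X(1) b(1)[OF iD] by (intro mult_mono) auto
      finally have "\<bar>z i\<bar> \<le> ?X * (2 * real B) + 2 * ?X" using dz[of i] i by linarith
      \<comment> \<open>The additive widening is absorbed by means of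
        \<open>1 \<le> B\<close>.\<close>
      moreover have "2 * ?X * 1 \<le> 2 * ?X * real B" using b(4) by (intro mult_left_mono) auto
      moreover have "M = ?X * (2 * real B) + 2 * ?X * real B" by (simp add: M_def)
      ultimately show ?thesis by linarith
    qed
    moreover have "z (r + q - 1) \<le> 3 * ?X" using dz[of "r + q - 1"] hT X(3) n by linarith
    ultimately show ?thesis using zC near(1) by blast
  qed
  have "emeasure (RH_volume r q) (nbhd (RH_metric r q) 1 (embed ` realisation_points V E))
      \<le> ennreal (exp 2 ^ (r + q) * ((2 * M) ^ (r + q - 1) * (3 * ?X)))"
    by (rule RH_volume_box[OF q]) (use box in \<open>auto simp: M_def\<close>)
  also have "exp 2 ^ (r + q) * ((2 * M) ^ (r + q - 1) * (3 * ?X)) = volume_const D * real B ^ Suc D"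
  proof -
    have "r + q - 1 = Suc D" using n by simp
    moreover have "(2 * M) ^ Suc D = (2 * (4 * ?X)) ^ Suc D * real B ^ Suc D"
      unfolding M_def by (simp only: power_mult_distrib mult.assoc)
    ultimately show ?thesis unfolding volume_const_def n by (simp only: mult_ac)
  qed
  finally show ?thesis by (simp add: embedding_volume_def)
qed

end

section \<open>Existence of the routing data\<close>

lemma exists_slots:
  assumes E: "finite E" and deg: "\<And>v. v \<in> V \<Longrightarrow> vertex_degree E v \<le> d"
  shows "\<exists>slot. \<forall>v\<in>V. inj_on (\<lambda>e. slot e v) {e \<in> E. v \<in> e} \<and> (\<forall>e\<in>E. v \<in> e \<longrightarrow> slot e v < d + 1)"
proof -
  \<comment> \<open>With \<open>d + 1\<close> slots instead of \<open>d\<close>, the block side is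
    positive also for \<open>d = 0\<close>.\<close>
  have "\<forall>v\<in>V. \<exists>s. s ` {e \<in> E. v \<in> e} \<subseteq> {..<d + 1} \<and> inj_on s {e \<in> E. v \<in> e}"
    using E deg by (intro ballI card_le_inj) (auto simp: vertex_degree_def le_SucI)
  then obtain s where "\<forall>v\<in>V. s v ` {e \<in> E. v \<in> e} \<subseteq> {..<d + 1} \<and> inj_on (s v) {e \<in> E. v \<in> e}"
    by (rule bchoice[THEN exE])
  then show ?thesis by (intro exI[of _ "\<lambda>e v. s v e"]) auto
qed

lemma exists_base:
  assumes V: "finite V" and L: "card V \<le> L ^ D"
  shows "\<exists>base. (\<forall>v\<in>V. \<forall>i<D. base v i < L) \<and>
    (\<forall>v\<in>V. \<forall>w\<in>V. v \<noteq> w \<longrightarrow> (\<exists>i<D. base v i \<noteq> (base w i :: nat)))"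
proof -
  let ?F = "\<Pi>\<^sub>E i\<in>{..<D}. {..<L}"
  have "card V \<le> card ?F" using L by (simp add: card_PiE)
  then obtain base where base: "base ` V \<subseteq> ?F" "inj_on base V"
    using card_le_inj[OF V, of ?F] by (auto simp: finite_PiE)
  have "base v i < L" if "v \<in> V" "i < D" for v i using base(1) that by auto
  moreover have "\<exists>i<D. base v i \<noteq> base w i" if vw: "v \<in> V" "w \<in> V" "v \<noteq> w" for v w
  proof (rule ccontr)
    assume "\<not> (\<exists>i<D. base v i \<noteq> base w i)"
    then have "base v = base w"
      by (intro PiE_ext[of _ "{..<D}" "\<lambda>_. {..<L}"]) (use base(1) vw in auto)
    then show False using base(2) vw by (auto dest: inj_onD)
  qed
  ultimately show ?thesis by blast
qed

text \<open>Ports of one vertex differ by their slot in coordinate \<open>0\<close>; for distinct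
  vertices, division by \<open>m\<close> recovers the base point.\<close>

lemma separating_ports:
  assumes D: "0 < D" and h: "\<And>e. e \<in> E \<Longrightarrow> h e \<in> V \<and> h e \<in> e"
    and base: "\<And>v w. v \<in> V \<Longrightarrow> w \<in> V \<Longrightarrow> v \<noteq> w \<Longrightarrow> \<exists>i<D. base v i \<noteq> base w i"
    and slot: "\<And>e v. e \<in> E \<Longrightarrow> v \<in> e \<Longrightarrow> slot e v < m"
      "\<And>e f v. e \<in> E \<Longrightarrow> f \<in> E \<Longrightarrow> v \<in> e \<Longrightarrow> v \<in> f \<Longrightarrow> e \<noteq> f \<Longrightarrow> slot e v \<noteq> slot f v"
  shows "separating D E (\<lambda>e. port m base slot e (h e))"
  unfolding separating_def
proof (intro ballI impI)
  fix e f assume ef: "e \<in> E" "f \<in> E" "e \<noteq> f"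
  show "\<exists>i<D. port m base slot e (h e) i \<noteq> port m base slot f (h f) i"
  proof (cases "h e = h f")
    case True
    then show ?thesis using slot(2)[OF ef(1,2) _ _ ef(3), of "h e"] h[OF ef(1)] h[OF ef(2)] D
      by (intro exI[of _ 0]) (auto simp: port_def)
  next
    case False
    then obtain i where i: "i < D" "base (h e) i \<noteq> base (h f) i" using base h ef by meson
    have div: "port m base slot e (h e) i div m = base (h e) i" if "e \<in> E" for e
      using slot(1)[OF that, of "h e"] h[OF that] by (auto simp: port_def)
    show ?thesis using i div[OF ef(1)] div[OF ef(2)] by metis
  qed
qed

lemma exists_routed_graph:
  assumes V: "finite V" and E: "simple_graph V E" and deg: "\<And>v. v \<in> V \<Longrightarrow> vertex_degree E v \<le> d"
    and D: "0 < D" and L: "card V \<le> L ^ D"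
  shows "\<exists>src tgt base slot c. routed_graph V E D (d + 1) ((d + 1) * L) src tgt base slot c"
proof -
  have "E \<subseteq> Pow V" using E by (auto simp: simple_graph_def)
  then have fE: "finite E" using V by (meson finite_Pow_iff finite_subset)
  have "\<forall>e\<in>E. \<exists>p. e = {fst p, snd p} \<and> fst p \<noteq> snd p"
    using E by (auto simp: simple_graph_def card_2_iff)
  then obtain p where p: "\<forall>e\<in>E. e = {fst (p e), snd (p e)} \<and> fst (p e) \<noteq> snd (p e)"
    by (rule bchoice[THEN exE])
  define src where "src = fst \<circ> p"
  define tgt where "tgt = snd \<circ> p"
  have ends: "e = {src e, tgt e} \<and> src e \<noteq> tgt e" if "e \<in> E" for e
    using bspec[OF p that] by (simp add: src_def tgt_def)
  have mem: "src e \<in> e" "tgt e \<in> e" if "e \<in> E" for e using ends[OF that] by auto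
  have sub: "v \<in> V" if "e \<in> E" "v \<in> e" for e v using \<open>E \<subseteq> Pow V\<close> that by blast
  obtain slot where slot: "\<forall>v\<in>V. inj_on (\<lambda>e. slot e v) {e \<in> E. v \<in> e} \<and> (\<forall>e\<in>E. v \<in> e \<longrightarrow> slot e v < d + 1)"
    using exists_slots[OF fE deg] by blast
  have slot_less: "slot e v < d + 1" if "e \<in> E" "v \<in> e" for e v using slot sub that by blast
  have slot_neq: "slot e v \<noteq> slot f v" if "e \<in> E" "f \<in> E" "v \<in> e" "v \<in> f" "e \<noteq> f" for e f v
  proof -
    have "inj_on (\<lambda>e. slot e v) {e \<in> E. v \<in> e}" using slot sub that by blast
    then show ?thesis using that by (auto dest: inj_onD)
  qed
  obtain base where base: "\<And>v i. v \<in> V \<Longrightarrow> i < D \<Longrightarrow> base v i < L"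
      "\<And>v w. v \<in> V \<Longrightarrow> w \<in> V \<Longrightarrow> v \<noteq> w \<Longrightarrow> \<exists>i<D. base v i \<noteq> base w i"
    using exists_base[OF V L] by metis
  have bound: "(d + 1) * base v i + (d + 1) \<le> (d + 1) * L" if "v \<in> V" "i < D" for v i
  proof -
    have "(d + 1) * Suc (base v i) \<le> (d + 1) * L" using base(1)[OF that] by (intro mult_le_mono2) simp
    then show ?thesis by simp
  qed
  let ?P = "port (d + 1) base slot"
  have less: "?P e v i < (d + 1) * L" if "e \<in> E" "v \<in> e" "i < D" for e v i
    using bound[OF sub[OF that(1,2)] that(3)] slot_less[OF that(1,2)] by (auto simp: port_def)
  have sep: "separating D E (\<lambda>e. ?P e (src e))" "separating D E (\<lambda>e. ?P e (tgt e))"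
    using mem sub by (intro separating_ports[OF D _ base(2) slot_less slot_neq]; blast)+
  obtain c where c: "\<forall>e\<in>E. \<forall>i<D. c e i < 2 * ((d + 1) * L)"
    "\<forall>k\<le>D. separating D E (\<lambda>e. splice k (c e) (?P e (src e))) \<and> separating D E (\<lambda>e. splice k (c e) (?P e (tgt e)))"
    using exists_intermediate_points[OF fE sep(1) _ sep(2) _ order_refl, of "(d + 1) * L"] less mem by blast
  have "routed_graph V E D (d + 1) ((d + 1) * L) src tgt base slot c"
  proof
    show "e \<in> E \<Longrightarrow> e = {src e, tgt e} \<and> src e \<noteq> tgt e \<and> src e \<in> V \<and> tgt e \<in> V" for e
      using ends mem sub by blast
  qed (use D V base(2) bound slot_less slot_neq c in auto)
  then show ?thesis by blast
qed

text \<open>Since \<open>N powr (1 / D)\<close> is at least \<open>1\<close> for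
  \<open>N > 0\<close>, rounding it up at most doubles it; for \<open>N = 0\<close> both
  vanish.\<close>

lemma side_length:
  fixes N D :: nat
  assumes D: "0 < D"
  defines "L \<equiv> nat \<lceil>real N powr (1 / real D)\<rceil>"
  shows "N \<le> L ^ D" and "real L ^ Suc D \<le> 2 ^ Suc D * real N powr (1 + 1 / real D)"
proof -
  have L: "real N powr (1 / real D) \<le> real L" unfolding L_def by linarith
  \<comment> \<open>The exponent \<open>k = 0\<close> is excluded because
    \<open>0 powr 0 = 0\<close>, whereas \<open>0 ^ 0 = 1\<close>.\<close>
  have pow: "(real N powr (1 / real D)) ^ k = real N powr (real k / real D)" if "0 < k" for k
    using that by (cases "N = 0") (auto simp: powr_realpow[symmetric] powr_powr)
  have "real N = (real N powr (1 / real D)) ^ D" using D by (cases "N = 0") (auto simp: pow)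
  also have "\<dots> \<le> real L ^ D" using L by (intro power_mono) auto
  finally show "N \<le> L ^ D" by (metis of_nat_le_iff of_nat_power)
  have "real L \<le> 2 * real N powr (1 / real D)"
  proof (cases "N = 0")
    case False
    then have "1 \<le> real N powr (1 / real D)" by (intro ge_one_powr_ge_zero) auto
    then show ?thesis unfolding L_def by linarith
  qed (simp add: L_def)
  then have "real L ^ Suc D \<le> (2 * real N powr (1 / real D)) ^ Suc D" by (intro power_mono) auto
  also have "\<dots> = 2 ^ Suc D * real N powr (real (Suc D) / real D)"
    by (simp only: power_mult_distrib pow[OF zero_less_Suc])
  also have "real (Suc D) / real D = 1 + 1 / real D" using D by (simp add: field_simps)
  finally show "real L ^ Suc D \<le> 2 ^ Suc D * real N powr (1 + 1 / real D)" .
qed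

theorem theorem1p6:
  fixes r q d :: nat
  assumes "q \<ge> 2" and "q + r \<ge> 3"
  shows "\<exists>C::real. \<forall>(V::'v set) E.
    finite V \<and> simple_graph V E \<and> (\<forall>v\<in>V. vertex_degree E v \<le> d) \<longrightarrow>
    (\<exists>g. thick_embedding (RH_metric r q) 1 V E g \<and>
      embedding_volume (RH_metric r q) (RH_volume r q) V E g
        \<le> ennreal (C * real (card V) powr (1 + 1 / (real q + real r - 2))))"
proof -
  define D where "D = r + q - 2"
  have dim: "0 < D" "r + q = D + 2" "real q + real r - 2 = real D" using assms by (auto simp: D_def)
  \<comment> \<open>The power of \<open>d + 1\<close> comes from the block side, that of
    \<open>2\<close> from rounding the number of blocks along a side.\<close>
  define C where "C = volume_const D * real (d + 1) ^ Suc D * 2 ^ Suc D"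
  have vc: "0 \<le> volume_const D" by (simp add: volume_const_def)
  show ?thesis
  proof (intro exI[of _ C] allI impI)
    fix V :: "'v set" and E
    assume VE: "finite V \<and> simple_graph V E \<and> (\<forall>v\<in>V. vertex_degree E v \<le> d)"
    define L where "L = nat \<lceil>real (card V) powr (1 / real D)\<rceil>"
    note L = side_length[OF dim(1), of "card V", folded L_def]
    obtain src tgt base slot c where "routed_graph V E D (d + 1) ((d + 1) * L) src tgt base slot c"
      using exists_routed_graph[of V E d D L] VE dim(1) L(1) by blast
    then interpret routed_graph V E D "d + 1" "(d + 1) * L" src tgt base slot c .
    have "volume_const D * real ((d + 1) * L) ^ Suc D =
        volume_const D * real (d + 1) ^ Suc D * real L ^ Suc D"
      by (simp only: of_nat_mult power_mult_distrib mult.assoc)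
    also have "\<dots> \<le> volume_const D * real (d + 1) ^ Suc D * (2 ^ Suc D * real (card V) powr (1 + 1 / real D))"
      using vc by (intro mult_left_mono L(2)) simp
    also have "\<dots> = C * real (card V) powr (1 + 1 / real D)" by (simp add: C_def)
    finally have "embedding_volume (RH_metric r q) (RH_volume r q) V E embed
        \<le> ennreal (C * real (card V) powr (1 + 1 / real D))"
      using embed_volume[OF dim(2)] assms by (meson ennreal_leI order_trans zero_less_numeral less_le_trans)
    then show "\<exists>g. thick_embedding (RH_metric r q) 1 V E g \<and>
      embedding_volume (RH_metric r q) (RH_volume r q) V E g
        \<le> ennreal (C * real (card V) powr (1 + 1 / (real q + real r - 2)))"
      using thick_embed[OF dim(2)] dim(3) by auto
  qed
qed

end
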